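(* Let $f(x)=\frac1N\sum_{i=1}^Nf(x,\xi_i)$ on $\mathbb R^d$ be the empirical risk of a dataset of $N$ points, satisfying $(L_0,L_1)$-generalized smoothness (with $L_0>0$, $L_1\ge0$) and the bounded variance assumption with constants $\tau_0>0$, $0\le\tau_1<1$ (both defined in the context), and let $r\in(0,1]$. Run DP-PSAC (defined in the context) with batch size $B$, noise multiplier $\sigma=c_2\frac{q\sqrt{T\log(1/\delta)}}{\epsilon}$, $q=B/N$ (the value that yields the $(\epsilon,\delta)$-differential privacy guarantee), and constant learning rate $$\eta=\sqrt{\frac{2B^2}{d\sigma^2T\,(L_0+L_1(\tau_0+1))}},$$ for $T\ge\mathcal O\big(N^2\epsilon^2/(d\log(1/\delta))\big)$ iterations, i.e. $T\ge\kappa N^2\epsilon^2/(d\log(1/\delta))$ for a suitable constant $\kappa$ depending only on $L_0,L_1,\tau_0,\tau_1,r,c_2$. If the number of samples satisfies $N\ge L_1A'(\epsilon,\delta,\tau,L,d,r)$, then $$\mathbb E\Big(\min_{0\le t<T}\|\nabla f(x_t)\|\Big)\le\mathcal O\left(\sqrt{\frac{\sqrt{d\log(1/\delta)}}{N\epsilon}}\right)+\frac{8\tau_0^2(1+\tau_0)}{3N(\tau_0,\tau_1,r)(1-\tau_1)^3\left(\tau_0+\frac{r(1-\tau_1)}{2\tau_0+r(1-\tau_1)}\right)(2\sqrt r-r)},$$ where the constant implied in $\mathcal O(\cdot)$ depends only on $L_0,L_1,\tau_0,\tau_1,r,c_2$ and $f(x_0)-f(x^* )$, with $x^*$ a minimizer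 of $f$.
   Context: $\|\cdot\|$ is the $\ell_2$ norm; $\epsilon>0$, $\delta\in(0,1)$; $f$ is assumed to have a minimizer $x^*$. The symbol $N$ without arguments is the dataset size, while $N(\tau_0,\tau_1,r)$ is the function $$N(\tau_0,\tau_1,r)=\min\left(\frac{\tau_0}{1-\tau_1},\ \frac{2\tau_0^2+r\tau_0(1-\tau_1)}{4\tau_0^2+2r\tau_0(1-\tau_1)+r(1-\tau_1)^2}\right).$$ $(L_0,L_1)$-generalized smoothness: for all $x,y\in\mathbb R^d$, $\|\nabla f(x)-\nabla f(y)\|\le(L_0+L_1\|\nabla f(x)\|)\|x-y\|$. Bounded variance: for all $x\in\mathbb R^d$, the stochastic gradient $g(x,\xi_i)=\nabla f(x,\xi_i)$ satisfies $\|g(x,\xi_i)-\nabla f(x)\|\le\tau_0+\tau_1\|\nabla f(x)\|$ with probability 1. DP-PSAC (with clipping parameter $C=1$, which is absorbed into the learning rate): starting from $x_0\in\mathbb R^d$, for $t=0,\dots,T-1$ sample $B$ data points uniformly with replacement from the dataset, let $g_{t,1},\dots,g_{t,B}$ be their gradients at $x_t$ (so each $g_{t,i}$ has conditional mean $\nabla f(x_t)$), set $w_{t,i}=1/\big(\|g_{t,i}\|+\frac{r}{\|g_{t,i}\|+r}\big)$, and update $$x_{t+1}=x_t-\frac{\eta}{B}\Big(\sum_{i=1}^Bw_{t,i}g_{t,i}+\mathcal N(0,\sigma^2I_d)\Big)$$ with fresh independent Gaussian noise. $c_1,c_2>0$ are absolute constants such that, for every $\epsilon\le c_1q^2T$ and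 $\delta>0$, DP-PSAC is $(\epsilon,\delta)$-differentially private whenever $\sigma\ge c_2q\sqrt{T\log(1/\delta)}/\epsilon$. The threshold on $N$ is given by $$L_1A'(\epsilon,\delta,\tau,L,d,r)=\frac{6L_1c_2}{\alpha\epsilon}\sqrt{\frac{2d\log(1/\delta)}{L_0+L_1(\tau_0+1)}},\qquad \alpha=\tfrac14N(\tau_0,\tau_1,r)(1-\tau_1)\min\left(\frac{\sqrt r}{\sqrt r+\tau_0},\ \frac{2\sqrt r-r}{\sqrt r-r+\tau_0}\right).$$ *)

theory Defs
  imports "HOL-Probability.Probability"
begin

text \<open>
  The constants of the result must not depend on the dimension, so the dimension \<open>d\<close> is a
  natural number that can be quantified inside formulas rather than a type. A point of
  \<open>d\<close>-dimensional space is a function on \<open>{..<d}\<close>, extended by \<open>undefined\<close>; these functions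
  form the space of the product measures over \<open>{..<d}\<close>.
\<close>

abbreviation vecs :: "nat \<Rightarrow> (nat \<Rightarrow> real) set"
  where "vecs d \<equiv> {..<d} \<rightarrow>\<^sub>E UNIV"

abbreviation vnorm :: "nat \<Rightarrow> (nat \<Rightarrow> real) \<Rightarrow> real"
  where "vnorm d x \<equiv> L2_set x {..<d}"

text \<open>
  Frechet gradients. The library notion lives on normed types and hence does not apply to
  \<^term>\<open>vecs d\<close>.
\<close>

definition has_grad :: "nat \<Rightarrow> ((nat \<Rightarrow> real) \<Rightarrow> real) \<Rightarrow> (nat \<Rightarrow> real) \<Rightarrow> (nat \<Rightarrow> real) \<Rightarrow> bool"
  where "has_grad d f x g \<longleftrightarrow> g \<in> vecs d \<and>
    (\<forall>e>0. \<exists>s>0. \<forall>y\<in>vecs d. vnorm d (\<lambda>j. y j - x j) < s \<longrightarrow>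
      \<bar>f y - f x - (\<Sum>j<d. g j * (y j - x j))\<bar> \<le> e * vnorm d (\<lambda>j. y j - x j))"

definition differentiable_vecs :: "nat \<Rightarrow> ((nat \<Rightarrow> real) \<Rightarrow> real) \<Rightarrow> bool"
  where "differentiable_vecs d f \<longleftrightarrow> (\<forall>x\<in>vecs d. \<exists>g. has_grad d f x g)"

definition grad :: "nat \<Rightarrow> ((nat \<Rightarrow> real) \<Rightarrow> real) \<Rightarrow> (nat \<Rightarrow> real) \<Rightarrow> (nat \<Rightarrow> real)"
  where "grad d f x = (THE g. has_grad d f x g)"

text \<open>
  A dataset of \<open>n\<close> points is given by its loss functions \<open>F i\<close>, \<open>i < n\<close>; drawing a data point
  uniformly is drawing its index from \<^term>\<open>uniform_count_measure {..<n}\<close>.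
\<close>

definition emp_risk :: "nat \<Rightarrow> (nat \<Rightarrow> (nat \<Rightarrow> real) \<Rightarrow> real) \<Rightarrow> (nat \<Rightarrow> real) \<Rightarrow> real"
  where "emp_risk n F x = (\<Sum>i<n. F i x) / real n"

definition generalized_smooth ::
    "nat \<Rightarrow> real \<Rightarrow> real \<Rightarrow> ((nat \<Rightarrow> real) \<Rightarrow> real) \<Rightarrow> bool"
  where "generalized_smooth d L\<^sub>0 L\<^sub>1 f \<longleftrightarrow> (\<forall>x\<in>vecs d. \<forall>y\<in>vecs d.
    vnorm d (\<lambda>j. grad d f x j - grad d f y j)
      \<le> (L\<^sub>0 + L\<^sub>1 * vnorm d (grad d f x)) * vnorm d (\<lambda>j. x j - y j))"

definition bounded_variance ::
    "nat \<Rightarrow> nat \<Rightarrow> real \<Rightarrow> real \<Rightarrow> (nat \<Rightarrow> (nat \<Rightarrow> real) \<Rightarrow> real) \<Rightarrow> bool"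
  where "bounded_variance d n \<tau>\<^sub>0 \<tau>\<^sub>1 F \<longleftrightarrow> (\<forall>x\<in>vecs d.
    AE i in uniform_count_measure {..<n}.
      vnorm d (\<lambda>j. grad d (F i) x j - grad d (emp_risk n F) x j)
        \<le> \<tau>\<^sub>0 + \<tau>\<^sub>1 * vnorm d (grad d (emp_risk n F) x))"

definition minimizer :: "nat \<Rightarrow> ((nat \<Rightarrow> real) \<Rightarrow> real) \<Rightarrow> (nat \<Rightarrow> real) \<Rightarrow> bool"
  where "minimizer d f x \<longleftrightarrow> x \<in> vecs d \<and> (\<forall>y\<in>vecs d. f x \<le> f y)"

definition psac_weight :: "real \<Rightarrow> real \<Rightarrow> real"
  where "psac_weight r s = 1 / (s + r / (s + r))"

text \<open>
  The randomness of step \<open>t\<close> is the pair \<open>\<omega> t = (I, z)\<close>: the indices \<open>I i\<close>, \<open>i < B\<close>, of the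
  sampled data points and the Gaussian noise \<open>z\<close>. Each iterate is a function of \<open>\<omega>\<close>.
\<close>

primrec dp_psac ::
    "nat \<Rightarrow> nat \<Rightarrow> real \<Rightarrow> real \<Rightarrow> (nat \<Rightarrow> (nat \<Rightarrow> real) \<Rightarrow> real) \<Rightarrow> (nat \<Rightarrow> real) \<Rightarrow>
     (nat \<Rightarrow> (nat \<Rightarrow> nat) \<times> (nat \<Rightarrow> real)) \<Rightarrow> nat \<Rightarrow> (nat \<Rightarrow> real)"
  where
    "dp_psac d B r \<eta> F x\<^sub>0 \<omega> 0 = x\<^sub>0"
  | "dp_psac d B r \<eta> F x\<^sub>0 \<omega> (Suc t) =
      (let x = dp_psac d B r \<eta> F x\<^sub>0 \<omega> t;
           g = (\<lambda>i. grad d (F (fst (\<omega> t) i)) x);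
           z = snd (\<omega> t)
       in (\<lambda>j\<in>{..<d}. x j - \<eta> / real B *
            ((\<Sum>i<B. psac_weight r (vnorm d (g i)) * g i j) + z j)))"

definition gaussian_noise :: "nat \<Rightarrow> real \<Rightarrow> (nat \<Rightarrow> real) measure"
  where "gaussian_noise d \<sigma> = (\<Pi>\<^sub>M j\<in>{..<d}. density lborel (normal_density 0 \<sigma>))"

definition dp_psac_space ::
    "nat \<Rightarrow> nat \<Rightarrow> nat \<Rightarrow> nat \<Rightarrow> real \<Rightarrow> (nat \<Rightarrow> (nat \<Rightarrow> nat) \<times> (nat \<Rightarrow> real)) measure"
  where "dp_psac_space d n B T \<sigma> = (\<Pi>\<^sub>M t\<in>{..<T}.
    (\<Pi>\<^sub>M i\<in>{..<B}. uniform_count_measure {..<n}) \<Otimes>\<^sub>M gaussian_noise d \<sigma>)"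

definition N_fun :: "real \<Rightarrow> real \<Rightarrow> real \<Rightarrow> real"
  where "N_fun \<tau>\<^sub>0 \<tau>\<^sub>1 r = min (\<tau>\<^sub>0 / (1 - \<tau>\<^sub>1))
    ((2 * \<tau>\<^sub>0\<^sup>2 + r * \<tau>\<^sub>0 * (1 - \<tau>\<^sub>1)) /
     (4 * \<tau>\<^sub>0\<^sup>2 + 2 * r * \<tau>\<^sub>0 * (1 - \<tau>\<^sub>1) + r * (1 - \<tau>\<^sub>1)\<^sup>2))"

definition alpha :: "real \<Rightarrow> real \<Rightarrow> real \<Rightarrow> real"
  where "alpha \<tau>\<^sub>0 \<tau>\<^sub>1 r = 1 / 4 * N_fun \<tau>\<^sub>0 \<tau>\<^sub>1 r * (1 - \<tau>\<^sub>1) *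
    min (sqrt r / (sqrt r + \<tau>\<^sub>0)) ((2 * sqrt r - r) / (sqrt r - r + \<tau>\<^sub>0))"

text \<open>The lower bound \<open>L\<^sub>1 A'(\<epsilon>, \<delta>, \<tau>, L, d, r)\<close> on the number of samples.\<close>

definition sample_threshold ::
    "real \<Rightarrow> real \<Rightarrow> real \<Rightarrow> real \<Rightarrow> real \<Rightarrow> real \<Rightarrow> nat \<Rightarrow> real \<Rightarrow> real \<Rightarrow> real"
  where "sample_threshold L\<^sub>0 L\<^sub>1 \<tau>\<^sub>0 \<tau>\<^sub>1 r c\<^sub>2 d \<epsilon> \<delta> =
    6 * L\<^sub>1 * c\<^sub>2 / (alpha \<tau>\<^sub>0 \<tau>\<^sub>1 r * \<epsilon>) *
      sqrt (2 * real d * ln (1 / \<delta>) / (L\<^sub>0 + L\<^sub>1 * (\<tau>\<^sub>0 + 1)))"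

end

theory Submission
  imports Defs
begin

text \<open>
  Beyond the noise floor \<open>\<tau>\<^sub>0 / (1 - \<tau>\<^sub>1)\<close> every weighted sampled gradient has inner product with
  the true gradient at least \<open>c\<close> times the excess of the true gradient's norm over the floor. By
  generalized smoothness the expected decrease of \<open>f\<close> in one step is then linear in this
  excess, up to a second-order term. For the prescribed \<open>\<eta>\<close> and \<open>\<sigma>\<close>, put
  \<open>s = sqrt (d ln (1/\<delta>)) / (n \<epsilon>)\<close>: then \<open>\<eta> T\<close> is a constant times \<open>1/s\<close>, and the second-order terms
  add up to a constant plus, when \<open>s\<close> is small, at most half of the decrease. Stopping the process
  at the first gradient below twice the floor, which is at most the bias of the claim, and summing
  the decreases bounds the expected excess of the minimum by \<open>O(s)\<close>. When \<open>s\<close> is not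
  small, the gradient at \<open>x\<^sub>0\<close>, bounded in terms of \<open>f x\<^sub>0 - f x\<^sup>*\<close>, is already \<open>O(sqrt s)\<close>.
\<close>

section \<open>Gradients of functions on vectors of variable dimension\<close>

lemma has_gradD:
  assumes "has_grad d f x g" and "e > 0"
  shows "\<exists>s>0. \<forall>y\<in>vecs d. vnorm d (\<lambda>j. y j - x j) < s \<longrightarrow>
    \<bar>f y - f x - (\<Sum>j<d. g j * (y j - x j))\<bar> \<le> e * vnorm d (\<lambda>j. y j - x j)"
  using assms by (simp add: has_grad_def)

text \<open>This reduces to one real variable: coordinate directions yield uniqueness and
  measurability of gradients, and the direction of a segment yields the descent inequality. The
  restriction to \<open>{..<d}\<close> keeps the moved point in \<open>vecs d\<close>.\<close>

lemma has_grad_DERIV: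
  assumes g: "has_grad d f x g" and x: "x \<in> vecs d"
  shows "((\<lambda>s. f (\<lambda>j\<in>{..<d}. x j + s * v j)) has_real_derivative (\<Sum>j<d. g j * v j)) (at 0)"
proof -
  have x_eq: "restrict x {..<d} = x"
    using x by (simp add: PiE_restrict)
  have "\<exists>s>0. \<forall>h. h \<noteq> 0 \<and> \<bar>h\<bar> < s \<longrightarrow>
      \<bar>(f (\<lambda>j\<in>{..<d}. x j + h * v j) - f x) / h - (\<Sum>j<d. g j * v j)\<bar> < e" if "e > 0" for e
  proof -
    define V where "V = vnorm d v"
    have V: "0 \<le> V" by (simp add: V_def)
    \<comment> \<open>The \<open>+ 1\<close> keeps the quotient sensible for a vanishing direction
      and makes \<open>e' * V < e\<close> strict.\<close>
    define e' where "e' = e / (V + 1)"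
    have "e' > 0"
      unfolding e'_def using V that by (intro divide_pos_pos) auto
    from has_gradD[OF g \<open>e' > 0\<close>]
    obtain s where s: "s > 0" and s_approx: "\<forall>y\<in>vecs d. vnorm d (\<lambda>j. y j - x j) < s \<longrightarrow>
        \<bar>f y - f x - (\<Sum>j<d. g j * (y j - x j))\<bar> \<le> e' * vnorm d (\<lambda>j. y j - x j)"
      by (elim exE conjE) (rule that)
    have "\<bar>(f (\<lambda>j\<in>{..<d}. x j + h * v j) - f x) / h - (\<Sum>j<d. g j * v j)\<bar> < e"
      if h: "h \<noteq> 0" "\<bar>h\<bar> < s / (V + 1)" for h
    proof -
      define y where "y = (\<lambda>j\<in>{..<d}. x j + h * v j)"
      have "vnorm d (\<lambda>j. y j - x j) = vnorm d (\<lambda>j. h * v j)"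
        by (rule L2_set_cong) (auto simp: y_def)
      also have "\<dots> = \<bar>h\<bar> * V"
        by (simp only: V_def L2_set_def power_mult_distrib sum_distrib_left[symmetric]
            real_sqrt_mult real_sqrt_abs)
      finally have nrm: "vnorm d (\<lambda>j. y j - x j) = \<bar>h\<bar> * V" .
      have sm: "(\<Sum>j<d. g j * (y j - x j)) = h * (\<Sum>j<d. g j * v j)"
        by (simp add: y_def sum_distrib_left mult_ac)
      have "\<bar>h\<bar> * V \<le> \<bar>h\<bar> * (V + 1)" by (simp add: mult_left_mono)
      also have "\<dots> < s" using h V by (simp add: field_simps)
      finally have "\<bar>f y - f x - h * (\<Sum>j<d. g j * v j)\<bar> \<le> e' * (\<bar>h\<bar> * V)"
        using s_approx[rule_format, of y] nrm sm by (simp add: y_def)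
      also have "\<dots> < e * \<bar>h\<bar>"
      proof -
        have "e' * V < e" using V \<open>e > 0\<close> by (simp add: e'_def field_simps)
        then have "(e' * V) * \<bar>h\<bar> < e * \<bar>h\<bar>" using h(1) by simp
        then show ?thesis by (simp only: mult_ac)
      qed
      finally have "\<bar>f y - f x - h * (\<Sum>j<d. g j * v j)\<bar> / \<bar>h\<bar> < e"
        using h(1) by (simp add: divide_less_eq)
      also have "\<bar>f y - f x - h * (\<Sum>j<d. g j * v j)\<bar> / \<bar>h\<bar>
          = \<bar>(f y - f x) / h - (\<Sum>j<d. g j * v j)\<bar>"
        using h(1) by (simp add: diff_divide_distrib flip: abs_divide)
      finally show ?thesis by (simp add: y_def)
    qed
    moreover have "s / (V + 1) > 0" using s V by simp
    ultimately show ?thesis by blast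
  qed
  then show ?thesis
    by (simp add: DERIV_def LIM_eq x_eq)
qed

text \<open>Derivatives along unit vectors fix the coordinates below \<open>d\<close>; the remaining
  ones are \<open>undefined\<close> on both sides. This justifies the description in
  \<open>grad\<close>.\<close>

lemma has_grad_unique:
  assumes "has_grad d f x g" "has_grad d f x g'" and x: "x \<in> vecs d"
  shows "g = g'"
proof (rule PiE_ext)
  show "g \<in> vecs d" "g' \<in> vecs d"
    using assms by (auto simp: has_grad_def)
  fix i assume i: "i \<in> {..<d}"
  let ?v = "\<lambda>j. if j = i then 1 else (0::real)"
  have "(\<Sum>j<d. g j * ?v j) = (\<Sum>j<d. g' j * ?v j)"
    using has_grad_DERIV[OF assms(1) x] has_grad_DERIV[OF assms(2) x] by (rule DERIV_unique)
  then show "g i = g' i"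
    using i by (simp add: if_distrib cong: if_cong)
qed

lemma grad_eqI: "has_grad d f x g \<Longrightarrow> x \<in> vecs d \<Longrightarrow> grad d f x = g"
  unfolding grad_def by (blast intro: has_grad_unique the_equality)

lemma has_grad_grad: "differentiable_vecs d f \<Longrightarrow> x \<in> vecs d \<Longrightarrow> has_grad d f x (grad d f x)"
  unfolding differentiable_vecs_def using grad_eqI by metis

lemma grad_in_vecs: "differentiable_vecs d f \<Longrightarrow> x \<in> vecs d \<Longrightarrow> grad d f x \<in> vecs d"
  using has_grad_grad has_grad_def by metis

text \<open>The average of the gradients works: the smallest of the finitely many radii serves all
  losses at once, and the errors average to at most the common bound.\<close>

lemma differentiable_emp_risk:
  assumes n: "n \<ge> 1" and F: "\<forall>i<n. differentiable_vecs d (F i)"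
  shows "differentiable_vecs d (emp_risk n F)"
  unfolding differentiable_vecs_def
proof
  fix x assume x: "x \<in> vecs d"
  define g where "g = (\<lambda>j\<in>{..<d}. (\<Sum>i<n. grad d (F i) x j) / real n)"
  have "\<exists>s>0. \<forall>y\<in>vecs d. vnorm d (\<lambda>j. y j - x j) < s \<longrightarrow>
      \<bar>emp_risk n F y - emp_risk n F x - (\<Sum>j<d. g j * (y j - x j))\<bar> \<le> e * vnorm d (\<lambda>j. y j - x j)"
    if "e > 0" for e
  proof -
    have "\<forall>i\<in>{..<n}. \<exists>s>0. \<forall>y\<in>vecs d. vnorm d (\<lambda>j. y j - x j) < s \<longrightarrow>
      \<bar>F i y - F i x - (\<Sum>j<d. grad d (F i) x j * (y j - x j))\<bar> \<le> e * vnorm d (\<lambda>j. y j - x j)"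
      using F has_grad_grad[OF _ x] that unfolding has_grad_def by blast
    then obtain s where s: "\<And>i. i < n \<Longrightarrow> s i > 0"
      "\<And>i y. i < n \<Longrightarrow> y \<in> vecs d \<Longrightarrow> vnorm d (\<lambda>j. y j - x j) < s i \<Longrightarrow>
        \<bar>F i y - F i x - (\<Sum>j<d. grad d (F i) x j * (y j - x j))\<bar> \<le> e * vnorm d (\<lambda>j. y j - x j)"
      unfolding bchoice_iff by auto
    have ne: "s ` {..<n} \<noteq> {}" using n by (simp add: lessThan_empty_iff)
    have "\<bar>emp_risk n F y - emp_risk n F x - (\<Sum>j<d. g j * (y j - x j))\<bar> \<le> e * vnorm d (\<lambda>j. y j - x j)"
      if y: "y \<in> vecs d" "vnorm d (\<lambda>j. y j - x j) < Min (s ` {..<n})" for y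
    proof -
      let ?E = "\<lambda>i. F i y - F i x - (\<Sum>j<d. grad d (F i) x j * (y j - x j))"
      have "(\<Sum>j<d. g j * (y j - x j)) = (\<Sum>i<n. \<Sum>j<d. grad d (F i) x j * (y j - x j)) / n"
        by (subst sum.swap)
          (simp add: g_def sum_distrib_right sum_distrib_left sum_divide_distrib)
      then have "emp_risk n F y - emp_risk n F x - (\<Sum>j<d. g j * (y j - x j)) = (\<Sum>i<n. ?E i) / n"
        by (simp add: emp_risk_def sum_subtractf diff_divide_distrib)
      then have "\<bar>emp_risk n F y - emp_risk n F x - (\<Sum>j<d. g j * (y j - x j))\<bar>
          = \<bar>\<Sum>i<n. ?E i\<bar> / n" by simp
      also have "\<dots> \<le> (\<Sum>i<n. \<bar>?E i\<bar>) / n"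
        by (simp add: divide_right_mono)
      also have "\<dots> \<le> (\<Sum>i<n. e * vnorm d (\<lambda>j. y j - x j)) / n"
        using y ne by (intro divide_right_mono sum_mono s(2)) (auto)
      also have "\<dots> = e * vnorm d (\<lambda>j. y j - x j)" using n by simp
      finally show ?thesis .
    qed
    moreover have "Min (s ` {..<n}) > 0" using ne s(1) by auto
    ultimately show ?thesis by blast
  qed
  then have "has_grad d (emp_risk n F) x g"
    unfolding has_grad_def g_def by auto
  then show "\<exists>g. has_grad d (emp_risk n F) x g" by (rule exI[of _ g])
qed

section \<open>Measurability of differentiable functions and of their gradients\<close>

text \<open>Differentiability gives continuity, but the space of the product measure carries no
  topology of its own. So \<open>f\<close> is extended to \<open>h\<close> on all functions by
  restriction of the argument; \<open>h\<close> is continuous for the product topology, hence Borel.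
  Padding by 0 then maps the product space measurably into the full product, whose sets are the
  Borel sets.\<close>

lemma borel_measurable_differentiable_vecs:
  assumes f: "differentiable_vecs d f"
  shows "f \<in> borel_measurable (\<Pi>\<^sub>M j\<in>{..<d}. borel)"
proof -
  define h where "h = (\<lambda>y::nat \<Rightarrow> real. f (restrict y {..<d}))"
  have "isCont h x" for x
  proof -
    define z where "z = restrict x {..<d}"
    have z: "z \<in> vecs d" by (simp add: z_def)
    define g where "g = grad d f z"
    have g: "has_grad d f z g"
      unfolding g_def by (rule has_grad_grad[OF f z])
    from has_gradD[OF g zero_less_one]
    obtain s where s: "s > 0" and s_lip: "\<forall>y\<in>vecs d. vnorm d (\<lambda>j. y j - z j) < s \<longrightarrow>
        \<bar>f y - f z - (\<Sum>j<d. g j * (y j - z j))\<bar> \<le> 1 * vnorm d (\<lambda>j. y j - z j)"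
      by (elim exE conjE) (rule that)
    define q where "q = (\<lambda>y. vnorm d (\<lambda>j. y j - x j))"
    \<comment> \<open>Differentiability with error 1 bounds the increment of \<open>h\<close> by
      \<open>l\<close> near \<open>x\<close>; \<open>l\<close> tends to 0 because it involves only
      finitely many coordinates.\<close>
    define l where "l = (\<lambda>y. \<bar>\<Sum>j<d. g j * (y j - x j)\<bar> + q y)"
    have crd: "((\<lambda>y. y j) \<longlongrightarrow> x j) (nhds x)" for j
    proof -
      have "isCont (\<lambda>y. y j) x"
        by (rule continuous_on_eq_continuous_at[THEN iffD1, rule_format,
              OF open_UNIV continuous_on_product_coordinates]) simp
      then show ?thesis
        by (simp add: continuous_at tendsto_nhds_iff)
    qed
    have "(q \<longlongrightarrow> sqrt (\<Sum>j<d. (x j - x j)\<^sup>2)) (nhds x)"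
      unfolding q_def L2_set_def by (intro tendsto_real_sqrt tendsto_sum tendsto_power tendsto_diff[OF crd tendsto_const])
    then have "(q \<longlongrightarrow> 0) (nhds x)" by simp
    then have q: "(q \<longlongrightarrow> 0) (nhds x)" "\<forall>\<^sub>F y in nhds x. q y < s"
      using s by (auto simp: order_tendsto_iff)
    have "(l \<longlongrightarrow> \<bar>\<Sum>j<d. g j * (x j - x j)\<bar> + 0) (nhds x)"
      unfolding l_def by (intro tendsto_add q(1) tendsto_rabs tendsto_sum tendsto_mult tendsto_const tendsto_diff[OF crd tendsto_const])
    then have l: "(l \<longlongrightarrow> 0) (nhds x)" by simp
    have "\<forall>\<^sub>F y in nhds x. \<bar>h y - h x\<bar> \<le> l y"
      using q(2)
    proof eventually_elim
      case (elim y)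
      have "vnorm d (\<lambda>j. restrict y {..<d} j - z j) = q y"
        unfolding q_def z_def by (rule L2_set_cong) auto
      moreover have "(\<Sum>j<d. g j * (restrict y {..<d} j - z j)) = (\<Sum>j<d. g j * (y j - x j))"
        by (simp add: z_def)
      ultimately show ?case
        using s_lip[rule_format, of "restrict y {..<d}"] elim by (auto simp: h_def l_def z_def)
    qed
    then have "((\<lambda>y. h y - h x) \<longlongrightarrow> 0) (nhds x)"
      by (intro Lim_null_comparison[OF _ l]) simp
    then show ?thesis
      by (simp add: LIM_zero_iff continuous_at tendsto_nhds_iff)
  qed
  then have "continuous_on UNIV h"
    by (simp add: continuous_on_eq_continuous_at)
  then have h [measurable]: "h \<in> borel_measurable borel"
    by (rule borel_measurable_continuous_onI)
  have "(\<lambda>x j. if j < d then x j else 0) \<in> measurable (\<Pi>\<^sub>M j\<in>{..<d}. borel) (\<Pi>\<^sub>M j\<in>UNIV. (borel :: real measure))"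
  proof (rule measurable_PiM_single')
    fix j :: nat
    show "(\<lambda>x. if j < d then x j else 0) \<in> borel_measurable (\<Pi>\<^sub>M j\<in>{..<d}. (borel :: real measure))"
      by (cases "j < d") simp_all
  qed (auto simp: space_PiM)
  then have "(\<lambda>x j. if j < d then x j else 0) \<in> measurable (\<Pi>\<^sub>M j\<in>{..<d}. borel) (borel :: (nat \<Rightarrow> real) measure)"
    by (simp only: measurable_cong_sets[OF refl sets_PiM_equal_borel])
  then have "(\<lambda>x. h (\<lambda>j. if j < d then x j else 0)) \<in> borel_measurable (\<Pi>\<^sub>M j\<in>{..<d}. borel)"
    by measurable
  then show ?thesis
  proof (rule measurable_cong[THEN iffD1, rotated])
    fix x :: "nat \<Rightarrow> real" assume "x \<in> space (\<Pi>\<^sub>M j\<in>{..<d}. borel)"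
    then have "x \<in> vecs d" by (simp add: space_PiM)
    then have "restrict (\<lambda>j. if j < d then x j else 0) {..<d} = x"
      by (auto simp: fun_eq_iff restrict_def PiE_def extensional_def)
    then show "h (\<lambda>j. if j < d then x j else 0) = f x"
      by (simp add: h_def)
  qed
qed

text \<open>A coordinate below \<open>d\<close> is a pointwise limit of difference quotients of
  \<open>f\<close> with steps tending to 0, each of them measurable; any other coordinate is
  constant.\<close>

lemma borel_measurable_grad:
  assumes f: "differentiable_vecs d f"
  shows "(\<lambda>x. grad d f x j) \<in> borel_measurable (\<Pi>\<^sub>M j\<in>{..<d}. borel)"
proof (cases "j < d")
  case False
  then have "grad d f x j = undefined" if "x \<in> vecs d" for x
    using grad_in_vecs[OF f that] by auto
  then show ?thesis
    by (subst measurable_cong[where g = "\<lambda>_. undefined"]) (auto simp: space_PiM)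
next
  case True
  note [measurable] = borel_measurable_differentiable_vecs[OF f]
  define v where "v = (\<lambda>i. if i = j then 1 else (0::real))"
  let ?s = "\<lambda>m. inverse (real (Suc m))"
  show ?thesis
  proof (rule borel_measurable_LIMSEQ_real)
    fix x assume "x \<in> space (\<Pi>\<^sub>M j\<in>{..<d}. (borel :: real measure))"
    then have x: "x \<in> vecs d" by (simp add: space_PiM)
    let ?q = "\<lambda>h. (f (\<lambda>i\<in>{..<d}. x i + h * v i) - f x) / h"
    have "(?q \<longlongrightarrow> (\<Sum>i<d. grad d f x i * v i)) (at 0)"
      using has_grad_DERIV[OF has_grad_grad[OF f x] x, of v] x
      by (simp add: DERIV_def PiE_restrict)
    also have "(\<Sum>i<d. grad d f x i * v i) = grad d f x j"
      using True by (simp add: v_def if_distrib cong: if_cong)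
    finally have "(?q \<longlongrightarrow> grad d f x j) (at 0)" .
    moreover have "filterlim ?s (at 0) sequentially"
      unfolding filterlim_at using LIMSEQ_inverse_real_of_nat by auto
    ultimately show "(\<lambda>m. (f (\<lambda>i\<in>{..<d}. x i + ?s m * v i) - f x) / ?s m) \<longlonglongrightarrow> grad d f x j"
      by (rule filterlim_compose)
  next
    fix m
    have [measurable]: "(\<lambda>x. \<lambda>i\<in>{..<d}. x i + ?s m * v i)
        \<in> measurable (\<Pi>\<^sub>M j\<in>{..<d}. borel) (\<Pi>\<^sub>M j\<in>{..<d}. (borel :: real measure))"
      by (rule measurable_restrict) simp
    show "(\<lambda>x. (f (\<lambda>i\<in>{..<d}. x i + ?s m * v i) - f x) / ?s m)
        \<in> borel_measurable (\<Pi>\<^sub>M j\<in>{..<d}. borel)"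
      by measurable
  qed
qed

section \<open>Consequences of generalized smoothness\<close>

text \<open>Smoothness is always applied with \<open>x\<close> as its first point, so only the
  gradient norm at \<open>x\<close> enters the constant \<open>M\<close>. By Cauchy-Schwarz the
  derivative along the segment from \<open>x\<close> to \<open>y\<close> then exceeds its initial
  value by at most \<open>M * V\<^sup>2 * s\<close>.\<close>

lemma generalized_smooth_descent:
  assumes f: "differentiable_vecs d f" and sm: "generalized_smooth d L\<^sub>0 L\<^sub>1 f"
    and x: "x \<in> vecs d" and y: "y \<in> vecs d"
  shows "f y \<le> f x + (\<Sum>j<d. grad d f x j * (y j - x j))
    + (L\<^sub>0 + L\<^sub>1 * vnorm d (grad d f x)) / 2 * (vnorm d (\<lambda>j. y j - x j))\<^sup>2"
proof -
  define v where "v = (\<lambda>j. y j - x j)"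
  define M where "M = L\<^sub>0 + L\<^sub>1 * vnorm d (grad d f x)"
  define V where "V = vnorm d v"
  define p where "p = (\<lambda>s. (\<lambda>j\<in>{..<d}. x j + s * v j))"
  define D where "D = (\<lambda>s. \<Sum>j<d. grad d f (p s) j * v j)"
  have p: "p s \<in> vecs d" for s by (simp add: p_def)
  have p0: "p 0 = x" and p1: "p 1 = y"
    using PiE_restrict[OF x] PiE_restrict[OF y]
    by (auto simp: p_def v_def)
  have der: "((\<lambda>s. f (p s)) has_real_derivative D s) (at s)" for s
  proof -
    have eq: "(\<lambda>j\<in>{..<d}. p s j + h * v j) = p (h + s)" for h
      by (auto simp: p_def fun_eq_iff algebra_simps)
    from has_grad_DERIV[OF has_grad_grad[OF f p] p, of s v]
    have "((\<lambda>h. f (p (h + s))) has_real_derivative D s) (at 0)"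
      unfolding eq D_def .
    then show ?thesis
      using DERIV_shift[of "\<lambda>s. f (p s)" "D s" 0 s] by simp
  qed
  have D: "D s \<le> D 0 + M * V\<^sup>2 * s" if "s \<ge> 0" for s
  proof -
    have "vnorm d (\<lambda>j. x j - p s j) = vnorm d (\<lambda>j. s * v j)"
      unfolding L2_set_def by (simp add: p_def)
    also have "\<dots> = s * V"
      using that by (simp add: V_def L2_set_right_distrib)
    finally have nrm: "vnorm d (\<lambda>j. x j - p s j) = s * V" .
    have "D s - D 0 = (\<Sum>j<d. (grad d f (p s) j - grad d f x j) * v j)"
      by (simp add: D_def p0 sum_subtractf left_diff_distrib)
    also have "\<dots> \<le> (\<Sum>j<d. \<bar>grad d f x j - grad d f (p s) j\<bar> * \<bar>v j\<bar>)"
      by (intro sum_mono) (metis abs_ge_self abs_minus_commute abs_mult)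
    also have "\<dots> \<le> vnorm d (\<lambda>j. grad d f x j - grad d f (p s) j) * V"
      unfolding V_def by (rule L2_set_mult_ineq)
    also have "\<dots> \<le> (M * (s * V)) * V"
    proof (rule mult_right_mono)
      show "vnorm d (\<lambda>j. grad d f x j - grad d f (p s) j) \<le> M * (s * V)"
        using sm x p[of s] unfolding generalized_smooth_def M_def nrm[symmetric] by blast
    qed (simp add: V_def)
    finally show ?thesis by (simp add: power2_eq_square algebra_simps)
  qed
  \<comment> \<open>\<open>\<psi>\<close> is \<open>f\<close> along the segment minus the linear and
    quadratic terms of the claim. Its derivative is nonpositive on [0, 1], so monotonicity replaces
    integration of \<open>D\<close>.\<close>
  define \<psi> where "\<psi> = (\<lambda>s. f (p s) - D 0 * s - M * V\<^sup>2 / 2 * s\<^sup>2)"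
  have "\<psi> 1 \<le> \<psi> 0"
  proof (rule DERIV_nonpos_imp_nonincreasing[of 0 1 \<psi>])
    fix s :: real assume "0 \<le> s" "s \<le> 1"
    have "(\<psi> has_real_derivative D s - D 0 - M * V\<^sup>2 * s) (at s)"
      unfolding \<psi>_def by (rule derivative_eq_intros der refl | simp)+
    then show "\<exists>y. (\<psi> has_real_derivative y) (at s) \<and> y \<le> 0"
      using D[OF \<open>0 \<le> s\<close>] by (intro exI conjI) auto
  qed simp
  then show ?thesis
    by (simp add: \<psi>_def p0 p1 D_def M_def V_def v_def)
qed

text \<open>A gradient step of size \<open>1 / M\<close> from \<open>x\<close> cannot fall below the
  minimum, so the squared gradient norm is at most \<open>2 * M\<close> times the gap. As
  \<open>M\<close> is affine in the norm, one factor of the norm cancels when it exceeds 1; the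
  summand 1 covers the other case.\<close>

lemma grad_norm_le_gap:
  assumes f: "differentiable_vecs d f" and sm: "generalized_smooth d L\<^sub>0 L\<^sub>1 f"
    and L: "L\<^sub>0 > 0" "L\<^sub>1 \<ge> 0" and x: "x \<in> vecs d" and m: "minimizer d f xm"
  shows "vnorm d (grad d f x) \<le> 1 + 2 * (f x - f xm) * (L\<^sub>0 + L\<^sub>1)"
proof -
  define G where "G = vnorm d (grad d f x)"
  have G: "G \<ge> 0" by (simp add: G_def)
  define M where "M = L\<^sub>0 + L\<^sub>1 * G"
  have M: "M > 0" using L G by (simp add: M_def add_pos_nonneg)
  define y where "y = (\<lambda>j\<in>{..<d}. x j - grad d f x j / M)"
  have "f xm \<le> f y" using m by (simp add: minimizer_def y_def)
  also have "f y \<le> f x + (\<Sum>j<d. grad d f x j * (y j - x j)) + M / 2 * (vnorm d (\<lambda>j. y j - x j))\<^sup>2"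
    unfolding M_def G_def by (rule generalized_smooth_descent[OF f sm x]) (simp add: y_def)
  also have "(\<Sum>j<d. grad d f x j * (y j - x j)) = - (G\<^sup>2 / M)"
    by (simp add: y_def G_def L2_set_def sum_nonneg sum_divide_distrib sum_negf power2_eq_square)
  also have "(vnorm d (\<lambda>j. y j - x j))\<^sup>2 = G\<^sup>2 / M\<^sup>2"
    by (simp add: y_def G_def L2_set_def sum_nonneg sum_divide_distrib power_divide)
  finally have "G\<^sup>2 / M \<le> 2 * (f x - f xm)"
    using M by (simp add: field_simps power2_eq_square)
  then have *: "G\<^sup>2 \<le> 2 * (f x - f xm) * (L\<^sub>0 + L\<^sub>1 * G)"
    using M by (simp add: field_simps M_def)
  have gap: "f x - f xm \<ge> 0" using m x by (auto simp: minimizer_def)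
  show ?thesis
  proof (cases "G \<le> 1")
    case True
    then show ?thesis
      unfolding G_def[symmetric] using gap L by (smt (verit) mult_nonneg_nonneg)
  next
    case False
    note *
    also have "2 * (f x - f xm) * (L\<^sub>0 + L\<^sub>1 * G) \<le> 2 * (f x - f xm) * ((L\<^sub>0 + L\<^sub>1) * G)"
      using False L gap by (intro mult_left_mono) (auto simp: algebra_simps)
    finally have "G * G \<le> (2 * (f x - f xm) * (L\<^sub>0 + L\<^sub>1)) * G"
      by (simp add: power2_eq_square mult_ac)
    then show ?thesis
      using False unfolding G_def[symmetric] by (simp add: mult_le_cancel_right)
  qed
qed

section \<open>Weighted gradients and Gaussian noise\<close>

lemma L2_set_sum_le: "L2_set (\<lambda>j. \<Sum>i\<in>I. h i j) A \<le> (\<Sum>i\<in>I. L2_set (h i) A)"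
proof (induction I rule: infinite_finite_induct)
  case (insert i I)
  then show ?case
    using L2_set_triangle_ineq[of "h i" "\<lambda>j. \<Sum>i\<in>I. h i j" A] by simp
qed (simp_all add: L2_set_def)

lemma L2_set_inner_le: "\<bar>\<Sum>j\<in>A. u j * v j\<bar> \<le> L2_set u A * L2_set v A"
proof -
  have "\<bar>\<Sum>j\<in>A. u j * v j\<bar> \<le> (\<Sum>j\<in>A. \<bar>u j\<bar> * \<bar>v j\<bar>)"
    using sum_abs[of "\<lambda>j. u j * v j" A] by (simp add: abs_mult)
  then show ?thesis
    using L2_set_mult_ineq order_trans by blast
qed

lemma psac_weight_nonneg: "r > 0 \<Longrightarrow> s \<ge> 0 \<Longrightarrow> psac_weight r s \<ge> 0"
  by (simp add: psac_weight_def)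

lemma psac_weight_mult_le_1: "r > 0 \<Longrightarrow> s \<ge> 0 \<Longrightarrow> psac_weight r s * s \<le> 1"
  by (simp add: psac_weight_def divide_le_eq_1 add_nonneg_pos add_pos_nonneg)

text \<open>The fraction in the denominator of the weight never exceeds 1, hence a bound free of
  \<open>r\<close>.\<close>

lemma psac_weight_ge:
  assumes "r > 0" "0 \<le> s" "s \<le> S"
  shows "1 / (S + 1) \<le> psac_weight r s"
  unfolding psac_weight_def
proof (rule divide_left_mono)
  have r: "r / (s + r) \<le> 1" "r / (s + r) > 0"
    using assms by (simp_all add: divide_le_eq_1)
  show "s + r / (s + r) \<le> S + 1"
    using assms r by linarith
  show "0 < (S + 1) * (s + r / (s + r))"
    using assms r by (intro mult_pos_pos) linarith+
qed simp

text \<open>Beyond the noise floor \<open>\<tau>\<^sub>0 / (1 - \<tau>\<^sub>1)\<close> every sampled gradient, and not only their mean, has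
  a nonnegative inner product with the true gradient \<open>u\<close>.\<close>

lemma psac_weight_inner_ge:
  assumes r: "0 < r" and \<tau>: "0 < \<tau>\<^sub>0" "0 \<le> \<tau>\<^sub>1" "\<tau>\<^sub>1 < 1"
    and g: "vnorm d (\<lambda>j. g j - u j) \<le> \<tau>\<^sub>0 + \<tau>\<^sub>1 * vnorm d u"
    and u: "\<tau>\<^sub>0 / (1 - \<tau>\<^sub>1) \<le> vnorm d u"
  shows "(1 - \<tau>\<^sub>1) * \<tau>\<^sub>0 / (2 * \<tau>\<^sub>0 + (1 - \<tau>\<^sub>1)) * (vnorm d u - \<tau>\<^sub>0 / (1 - \<tau>\<^sub>1))
    \<le> psac_weight r (vnorm d g) * (\<Sum>j<d. u j * g j)"
proof -
  define a where "a = 1 - \<tau>\<^sub>1"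
  define G where "G = vnorm d u"
  define c where "c = a * \<tau>\<^sub>0 / (2 * \<tau>\<^sub>0 + a)"
  define S where "S = G + \<tau>\<^sub>0 + \<tau>\<^sub>1 * G"
  have a: "0 < a" "a \<le> 1" using \<tau> by (auto simp: a_def)
  have G: "0 \<le> G" by (simp add: G_def)
  have aG: "\<tau>\<^sub>0 \<le> a * G" using u a by (simp add: a_def G_def divide_le_eq mult.commute)
  have S: "0 \<le> S" using G \<tau> by (simp add: S_def)
  have nrm: "vnorm d g \<le> S"
    using L2_set_triangle_ineq[of "\<lambda>j. g j - u j" u "{..<d}"] g by (simp add: S_def G_def)
  have "G\<^sup>2 + (\<Sum>j<d. u j * (g j - u j)) = (\<Sum>j<d. u j * g j)"
    by (simp add: G_def L2_set_def sum_nonneg algebra_simps sum_subtractf power2_eq_square)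
  moreover have "\<bar>\<Sum>j<d. u j * (g j - u j)\<bar> \<le> G * (\<tau>\<^sub>0 + \<tau>\<^sub>1 * G)"
    unfolding G_def by (rule order_trans[OF L2_set_inner_le mult_left_mono[OF g]]) simp
  ultimately have inner: "G * (a * G - \<tau>\<^sub>0) \<le> (\<Sum>j<d. u j * g j)"
    by (simp add: a_def algebra_simps power2_eq_square)
  \<comment> \<open>The weight may be as small as \<open>1 / (S + 1)\<close>, and \<open>S\<close>
    grows with \<open>G\<close>. Beyond the floor, however, \<open>G / (S + 1)\<close> is at least
    \<open>\<tau>\<^sub>0 / (2 * \<tau>\<^sub>0 + a)\<close>, with equality at
    \<open>a * G = \<tau>\<^sub>0\<close>; times \<open>a\<close> this is the constant
    \<open>c\<close>.\<close>
  have "\<tau>\<^sub>0 * (1 + \<tau>\<^sub>0) \<le> a * G * (1 + \<tau>\<^sub>0)"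
    using aG \<tau> by (intro mult_right_mono) auto
  then have "\<tau>\<^sub>0 * (S + 1) \<le> G * (2 * \<tau>\<^sub>0 + a)"
    by (simp add: S_def a_def algebra_simps)
  then have "\<tau>\<^sub>0 / (2 * \<tau>\<^sub>0 + a) * (S + 1) \<le> G"
    using \<tau> a by (simp add: divide_le_eq)
  then have "\<tau>\<^sub>0 / (2 * \<tau>\<^sub>0 + a) * (S + 1) * (a * G - \<tau>\<^sub>0) \<le> G * (a * G - \<tau>\<^sub>0)"
    using aG by (intro mult_right_mono) auto
  then have "\<tau>\<^sub>0 / (2 * \<tau>\<^sub>0 + a) * (a * G - \<tau>\<^sub>0) \<le> 1 / (S + 1) * (G * (a * G - \<tau>\<^sub>0))"
    using S by (simp add: le_divide_eq mult_ac)
  also have "\<dots> \<le> psac_weight r (vnorm d g) * (G * (a * G - \<tau>\<^sub>0))"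
    using r nrm aG G by (intro mult_right_mono psac_weight_ge mult_nonneg_nonneg) auto
  also have "\<dots> \<le> psac_weight r (vnorm d g) * (\<Sum>j<d. u j * g j)"
    using r inner by (intro mult_left_mono psac_weight_nonneg) auto
  also have "\<tau>\<^sub>0 / (2 * \<tau>\<^sub>0 + a) * (a * G - \<tau>\<^sub>0) = c * (G - \<tau>\<^sub>0 / a)"
    using a by (simp add: c_def right_diff_distrib mult.commute)
  finally show ?thesis by (simp add: c_def a_def G_def)
qed

section \<open>Moments of the Gaussian noise\<close>

lemma prob_space_gaussian_noise: "\<sigma> > 0 \<Longrightarrow> prob_space (gaussian_noise d \<sigma>)"
  unfolding gaussian_noise_def by (intro prob_space_PiM prob_space_normal_density)

lemma sets_gaussian_noise [measurable_cong]:
  "sets (gaussian_noise d \<sigma>) = sets (\<Pi>\<^sub>M j\<in>{..<d}. borel)"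
  unfolding gaussian_noise_def by (intro sets_PiM_cong) auto

lemma space_gaussian_noise: "space (gaussian_noise d \<sigma>) = vecs d"
  by (simp add: gaussian_noise_def space_PiM)

text \<open>A coordinate projection pushes the product measure forward to the one-dimensional normal
  law, whose first two moments are known.\<close>

lemma
  assumes \<sigma>: "\<sigma> > 0" and j: "j < d"
  shows integrable_gaussian_noise: "integrable (gaussian_noise d \<sigma>) (\<lambda>z. z j)"
    and integral_gaussian_noise: "(\<integral>z. z j \<partial>gaussian_noise d \<sigma>) = 0"
    and integrable_gaussian_noise_power2: "integrable (gaussian_noise d \<sigma>) (\<lambda>z. (z j)\<^sup>2)"
    and integral_gaussian_noise_power2: "(\<integral>z. (z j)\<^sup>2 \<partial>gaussian_noise d \<sigma>) = \<sigma>\<^sup>2"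
proof -
  let ?N = "density lborel (normal_density 0 \<sigma>)"
  have meas [measurable]: "(\<lambda>z. z j) \<in> measurable (gaussian_noise d \<sigma>) ?N"
    unfolding gaussian_noise_def using j by (intro measurable_component_singleton) auto
  have N: "distr (gaussian_noise d \<sigma>) ?N (\<lambda>z. z j) = ?N"
    unfolding gaussian_noise_def
    using j by (intro distr_PiM_component prob_space_normal_density \<sigma>) auto
  have 1: "has_bochner_integral ?N (\<lambda>x. x) 0"
    using normal_moment_odd[OF \<sigma>, of 0 0]
    by (simp add: has_bochner_integral_density)
  have 2: "has_bochner_integral ?N (\<lambda>x. x\<^sup>2) (\<sigma>\<^sup>2)"
    using normal_moment_even[OF \<sigma>, of 0 1]
    by (simp add: has_bochner_integral_density fact_numeral)
  have tr: "integrable (gaussian_noise d \<sigma>) (\<lambda>z. h (z j))"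
    "(\<integral>z. h (z j) \<partial>gaussian_noise d \<sigma>) = v"
    if h [measurable]: "h \<in> borel_measurable borel" and v: "has_bochner_integral ?N h v"
    for h :: "real \<Rightarrow> real" and v
    using integrable_distr[OF meas, of h] integral_distr[OF meas, of h] v
    by (auto simp: N has_bochner_integral_iff)
  show "integrable (gaussian_noise d \<sigma>) (\<lambda>z. z j)" "(\<integral>z. z j \<partial>gaussian_noise d \<sigma>) = 0"
    "integrable (gaussian_noise d \<sigma>) (\<lambda>z. (z j)\<^sup>2)" "(\<integral>z. (z j)\<^sup>2 \<partial>gaussian_noise d \<sigma>) = \<sigma>\<^sup>2"
    using tr[OF _ 1] tr[OF _ 2] by auto
qed

text \<open>The bound on \<open>f\<close> after one step has this form as a function of the noise:
  the linear part has mean 0 and each coordinate contributes its variance.\<close>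

lemma has_bochner_integral_gaussian_noise_quadratic:
  assumes \<sigma>: "\<sigma> > 0"
  shows "has_bochner_integral (gaussian_noise d \<sigma>)
    (\<lambda>z. a + (\<Sum>j<d. u j * z j) + c * (vnorm d z)\<^sup>2) (a + c * (d * \<sigma>\<^sup>2))"
proof -
  interpret prob_space "gaussian_noise d \<sigma>" by (rule prob_space_gaussian_noise[OF \<sigma>])
  let ?I = "has_bochner_integral (gaussian_noise d \<sigma>)"
  have "?I (\<lambda>z. \<Sum>j<d. u j * z j) (\<Sum>j<d. u j * 0)"
    using integrable_gaussian_noise[OF \<sigma>] integral_gaussian_noise[OF \<sigma>]
    by (intro has_bochner_integral_sum has_bochner_integral_mult_right)
      (auto simp: has_bochner_integral_iff)
  moreover have "?I (\<lambda>z. c * (\<Sum>j<d. (z j)\<^sup>2)) (c * (\<Sum>j<d. \<sigma>\<^sup>2))"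
    using integrable_gaussian_noise_power2[OF \<sigma>] integral_gaussian_noise_power2[OF \<sigma>]
    by (intro has_bochner_integral_sum has_bochner_integral_mult_right)
      (auto simp: has_bochner_integral_iff)
  moreover have "?I (\<lambda>z. a) a"
    by (simp add: has_bochner_integral_iff prob_space)
  ultimately have "?I (\<lambda>z. a + (\<Sum>j<d. u j * z j) + c * (\<Sum>j<d. (z j)\<^sup>2))
      (a + (\<Sum>j<d. u j * 0) + c * (\<Sum>j<d. \<sigma>\<^sup>2))"
    by (intro has_bochner_integral_add)
  then show ?thesis
    by (simp add: L2_set_def sum_nonneg)
qed

section \<open>One step of the iteration\<close>

text \<open>Current point and fresh randomness are separate arguments, so that the latter can be
  integrated out while the former is fixed.\<close>

definition psac_step ::
    "nat \<Rightarrow> nat \<Rightarrow> real \<Rightarrow> real \<Rightarrow> (nat \<Rightarrow> (nat \<Rightarrow> real) \<Rightarrow> real) \<Rightarrow> (nat \<Rightarrow> real) \<Rightarrow>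
     (nat \<Rightarrow> nat) \<times> (nat \<Rightarrow> real) \<Rightarrow> (nat \<Rightarrow> real)"
  where "psac_step d B r \<eta> F x y = (\<lambda>j\<in>{..<d}. x j - \<eta> / real B *
    ((\<Sum>i<B. psac_weight r (vnorm d (grad d (F (fst y i)) x)) * grad d (F (fst y i)) x j) + snd y j))"

lemma dp_psac_Suc:
  "dp_psac d B r \<eta> F x \<omega> (Suc t) = psac_step d B r \<eta> F (dp_psac d B r \<eta> F x \<omega> t) (\<omega> t)"
  by (simp add: psac_step_def Let_def)

lemma psac_step_in_vecs: "psac_step d B r \<eta> F x y \<in> vecs d"
  by (simp add: psac_step_def)

lemma dp_psac_in_vecs: "x \<in> vecs d \<Longrightarrow> dp_psac d B r \<eta> F x \<omega> t \<in> vecs d"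
  by (cases t) (simp_all add: dp_psac_Suc psac_step_in_vecs del: dp_psac.simps(2))

text \<open>The iterates are adapted. In this form the freshness of the randomness of a step is used
  later: changing \<open>\<omega> t\<close> leaves all iterates up to time \<open>t\<close>
  unchanged.\<close>

lemma dp_psac_cong:
  "(\<And>s. s < t \<Longrightarrow> \<omega> s = \<omega>' s) \<Longrightarrow> dp_psac d B r \<eta> F x \<omega> t = dp_psac d B r \<eta> F x \<omega>' t"
  by (induction t) (simp_all add: dp_psac_Suc del: dp_psac.simps(2))

abbreviation psac_step_space ::
    "nat \<Rightarrow> nat \<Rightarrow> nat \<Rightarrow> real \<Rightarrow> ((nat \<Rightarrow> nat) \<times> (nat \<Rightarrow> real)) measure"
  where "psac_step_space d n B \<sigma> \<equiv>
    (\<Pi>\<^sub>M i\<in>{..<B}. uniform_count_measure {..<n}) \<Otimes>\<^sub>M gaussian_noise d \<sigma>"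

lemma space_psac_step_space: "space (psac_step_space d n B \<sigma>) = ({..<B} \<rightarrow>\<^sub>E {..<n}) \<times> vecs d"
  by (simp add: space_pair_measure space_PiM space_gaussian_noise space_uniform_count_measure)

lemma prob_space_psac_step_space:
  assumes "n \<ge> 1" "\<sigma> > 0"
  shows "prob_space (psac_step_space d n B \<sigma>)"
  using assms by (intro prob_space_pair prob_space_PiM prob_space_uniform_count_measure
      prob_space_gaussian_noise) (auto simp: lessThan_empty_iff)

text \<open>The sampled index selects which loss is differentiated. Since it takes finitely many
  values, measurability may be checked for each fixed index \<open>k\<close>.\<close>

lemma measurable_psac_step:
  assumes F: "\<forall>i<n. differentiable_vecs d (F i)"
  shows "(\<lambda>(x, y). psac_step d B r \<eta> F x y)
    \<in> measurable ((\<Pi>\<^sub>M j\<in>{..<d}. borel) \<Otimes>\<^sub>M psac_step_space d n B \<sigma>) (\<Pi>\<^sub>M j\<in>{..<d}. borel)"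
proof -
  let ?V = "\<Pi>\<^sub>M j\<in>{..<d}. (borel :: real measure)"
  let ?P = "?V \<Otimes>\<^sub>M psac_step_space d n B \<sigma>"
  have [measurable]: "(\<lambda>p. psac_weight r (vnorm d (grad d (F (fst (snd p) i)) (fst p)))
      * grad d (F (fst (snd p) i)) (fst p) j) \<in> borel_measurable ?P" if "i < B" for i j
  proof (rule measurable_compose_countable'[where I = "{..<n}" and g = "\<lambda>p. fst (snd p) i"
        and f = "\<lambda>k p. psac_weight r (vnorm d (grad d (F k) (fst p))) * grad d (F k) (fst p) j"])
    fix k assume "k \<in> {..<n}"
    then have [measurable]: "(\<lambda>x. grad d (F k) x j) \<in> borel_measurable ?V" for j
      using F by (intro borel_measurable_grad) auto
    show "(\<lambda>p. psac_weight r (vnorm d (grad d (F k) (fst p))) * grad d (F k) (fst p) j)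
        \<in> borel_measurable ?P"
      unfolding psac_weight_def L2_set_def by measurable
  next
    have "(\<lambda>I. I i) \<in> measurable (\<Pi>\<^sub>M i\<in>{..<B}. uniform_count_measure {..<n}) (count_space {..<n})"
      using measurable_component_singleton[of i "{..<B}" "\<lambda>_. uniform_count_measure {..<n}"] that
      by (simp add: measurable_cong_sets[OF refl sets_uniform_count_measure_count_space])
    then show "(\<lambda>p. fst (snd p) i) \<in> measurable ?P (count_space {..<n})"
      by measurable
  qed simp
  show ?thesis
    unfolding psac_step_def case_prod_beta
    by (intro measurable_restrict) measurable
qed

lemma measurable_dp_psac:
  assumes F: "\<forall>i<n. differentiable_vecs d (F i)" and x: "x \<in> vecs d" and "t \<le> T"
  shows "(\<lambda>\<omega>. dp_psac d B r \<eta> F x \<omega> t) \<in> measurable (dp_psac_space d n B T \<sigma>) (\<Pi>\<^sub>M j\<in>{..<d}. borel)"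
  using \<open>t \<le> T\<close>
proof (induction t)
  case 0
  then show ?case using x by (simp add: space_PiM)
next
  case (Suc t)
  then have [measurable]: "(\<lambda>\<omega>. dp_psac d B r \<eta> F x \<omega> t)
      \<in> measurable (dp_psac_space d n B T \<sigma>) (\<Pi>\<^sub>M j\<in>{..<d}. borel)" by simp
  have [measurable]: "(\<lambda>\<omega>. \<omega> t) \<in> measurable (dp_psac_space d n B T \<sigma>) (psac_step_space d n B \<sigma>)"
    unfolding dp_psac_space_def using Suc.prems by (intro measurable_component_singleton) auto
  have "(\<lambda>\<omega>. (dp_psac d B r \<eta> F x \<omega> t, \<omega> t)) \<in> measurable (dp_psac_space d n B T \<sigma>)
      ((\<Pi>\<^sub>M j\<in>{..<d}. borel) \<Otimes>\<^sub>M psac_step_space d n B \<sigma>)"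
    by measurable
  from measurable_compose[OF this measurable_psac_step[OF F]] show ?case
    by (simp add: dp_psac_Suc del: dp_psac.simps(2))
qed

section \<open>Descent in one step, pathwise and in expectation\<close>

locale psac_run =
  fixes d n B :: nat and r \<eta> \<sigma> L\<^sub>0 L\<^sub>1 \<tau>\<^sub>0 \<tau>\<^sub>1 :: real
    and F :: "nat \<Rightarrow> (nat \<Rightarrow> real) \<Rightarrow> real" and xm :: "nat \<Rightarrow> real"
  assumes n: "n \<ge> 1" and B: "B \<ge> 1"
    and r: "r > 0" and \<eta>: "\<eta> \<ge> 0" and \<sigma>: "\<sigma> > 0" and L: "L\<^sub>0 > 0" "L\<^sub>1 \<ge> 0"
    and \<tau>: "\<tau>\<^sub>0 > 0" "0 \<le> \<tau>\<^sub>1" "\<tau>\<^sub>1 < 1"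
    and F: "\<forall>i<n. differentiable_vecs d (F i)"
    and smooth: "generalized_smooth d L\<^sub>0 L\<^sub>1 (emp_risk n F)"
    and var: "bounded_variance d n \<tau>\<^sub>0 \<tau>\<^sub>1 F"
    and xm: "minimizer d (emp_risk n F) xm"
begin

abbreviation "f \<equiv> emp_risk n F"
abbreviation "G x \<equiv> vnorm d (grad d f x)"
abbreviation "step \<equiv> psac_step d B r \<eta> F"
abbreviation "M \<equiv> psac_step_space d n B \<sigma>"
abbreviation "iter x\<^sub>0 \<omega> t \<equiv> dp_psac d B r \<eta> F x\<^sub>0 \<omega> t"

text \<open>At this norm \<open>G\<close> the deviation bound
  \<open>\<tau>\<^sub>0 + \<tau>\<^sub>1 * G\<close> equals \<open>G\<close>; below it a sampled
  gradient may point against the true one.\<close>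

definition "noise_floor = \<tau>\<^sub>0 / (1 - \<tau>\<^sub>1)"
text \<open>The factor supplied by \<open>psac_weight_inner_ge\<close>.\<close>

definition "c = (1 - \<tau>\<^sub>1) * \<tau>\<^sub>0 / (2 * \<tau>\<^sub>0 + (1 - \<tau>\<^sub>1))"

lemma f_diff: "differentiable_vecs d f"
  using n F by (rule differentiable_emp_risk)

lemma f_gap: "x \<in> vecs d \<Longrightarrow> f xm \<le> f x"
  using xm by (simp add: minimizer_def)

lemma prob_space_M: "prob_space M"
  using n \<sigma> by (rule prob_space_psac_step_space)

lemma measurable_f [measurable]: "f \<in> borel_measurable (\<Pi>\<^sub>M j\<in>{..<d}. borel)"
  by (rule borel_measurable_differentiable_vecs[OF f_diff])

lemma measurable_G [measurable]: "G \<in> borel_measurable (\<Pi>\<^sub>M j\<in>{..<d}. borel)"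
proof -
  note [measurable] = borel_measurable_grad[OF f_diff]
  show ?thesis unfolding L2_set_def by measurable
qed

text \<open>The uniform measure charges every index, so an almost sure bound holds for each of
  them.\<close>

lemma sampled_grad_close:
  assumes "x \<in> vecs d" "i < n"
  shows "vnorm d (\<lambda>j. grad d (F i) x j - grad d f x j) \<le> \<tau>\<^sub>0 + \<tau>\<^sub>1 * G x"
proof -
  have "AE i in uniform_count_measure {..<n}.
      vnorm d (\<lambda>j. grad d (F i) x j - grad d f x j) \<le> \<tau>\<^sub>0 + \<tau>\<^sub>1 * G x"
    using var assms(1) unfolding bounded_variance_def by (rule bspec)
  then show ?thesis
    unfolding uniform_count_measure_def AE_point_measure using assms(2)
    by (simp add: ennreal_zero_less_divide)
qed

text \<open>The descent inequality is applied for fixed randomness. Each weighted gradient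
  contributes at least \<open>h\<close> to the inner product and has norm at most 1, so the batch
  sum \<open>p\<close> has norm at most \<open>B\<close>. Splitting the square of
  \<open>p + z\<close> costs a factor 2, which cancels the 1/2 of the quadratic term. The part
  linear in the noise is kept because it has mean 0.\<close>

lemma step_descent:
  assumes x: "x \<in> vecs d" and G: "noise_floor \<le> G x" and y: "y \<in> space M"
  shows "f (step x y) \<le> f x - \<eta> * (c * (G x - noise_floor)) + (L\<^sub>0 + L\<^sub>1 * G x) * \<eta>\<^sup>2
    + (\<Sum>j<d. - (\<eta> / B * grad d f x j) * snd y j)
    + (L\<^sub>0 + L\<^sub>1 * G x) * \<eta>\<^sup>2 / (real B)\<^sup>2 * (vnorm d (snd y))\<^sup>2"
proof -
  define u where "u = grad d f x"
  define z where "z = snd y"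
  define g where "g = (\<lambda>i. grad d (F (fst y i)) x)"
  define w where "w = (\<lambda>i. psac_weight r (vnorm d (g i)))"
  define p where "p = (\<lambda>j. \<Sum>i<B. w i * g i j)"
  define h where "h = c * (G x - noise_floor)"
  define K where "K = L\<^sub>0 + L\<^sub>1 * G x"
  have K: "0 \<le> K" using L by (simp add: K_def)
  have Bpos: "real B > 0" using B by simp
  have upd: "step x y j - x j = - (\<eta> / B) * (p j + z j)" if "j < d" for j
    using that by (simp add: psac_step_def p_def w_def g_def z_def)
  have idx: "fst y i < n" if "i < B" for i
    using y that by (auto simp: space_psac_step_space PiE_def Pi_def)
  have "(\<Sum>i<B. h) \<le> (\<Sum>i<B. w i * (\<Sum>j<d. u j * g i j))"
  proof (rule sum_mono)
    fix i assume "i \<in> {..<B}"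
    then have "vnorm d (\<lambda>j. g i j - u j) \<le> \<tau>\<^sub>0 + \<tau>\<^sub>1 * vnorm d u"
      unfolding g_def u_def by (intro sampled_grad_close[OF x idx]) simp
    from psac_weight_inner_ge[OF r \<tau> this] G show "h \<le> w i * (\<Sum>j<d. u j * g i j)"
      by (simp add: h_def c_def noise_floor_def w_def u_def)
  qed
  also have "\<dots> = (\<Sum>i<B. \<Sum>j<d. u j * (w i * g i j))"
    by (simp add: sum_distrib_left mult_ac)
  also have "\<dots> = (\<Sum>j<d. \<Sum>i<B. u j * (w i * g i j))"
    by (rule sum.swap)
  also have "\<dots> = (\<Sum>j<d. u j * p j)"
    by (simp add: p_def sum_distrib_left)
  finally have hp: "B * h \<le> (\<Sum>j<d. u j * p j)" by simp
  have "vnorm d p \<le> (\<Sum>i<B. vnorm d (\<lambda>j. w i * g i j))"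
    unfolding p_def by (rule L2_set_sum_le)
  also have "\<dots> \<le> (\<Sum>i<B. 1)"
  proof (rule sum_mono)
    fix i
    have "vnorm d (\<lambda>j. w i * g i j) = w i * vnorm d (g i)"
      using r by (simp add: w_def L2_set_right_distrib psac_weight_nonneg)
    also have "\<dots> \<le> 1" unfolding w_def using r by (intro psac_weight_mult_le_1) auto
    finally show "vnorm d (\<lambda>j. w i * g i j) \<le> 1" .
  qed
  finally have np: "(vnorm d p)\<^sup>2 \<le> (real B)\<^sup>2" by (intro power_mono) auto
  have "(vnorm d (\<lambda>j. step x y j - x j))\<^sup>2 = (\<eta> / B)\<^sup>2 * (\<Sum>j<d. (p j + z j)\<^sup>2)"
    by (simp add: L2_set_def sum_nonneg upd power_mult_distrib power_divide sum_distrib_left)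
  also have "\<dots> \<le> (\<eta> / B)\<^sup>2 * (\<Sum>j<d. 2 * (p j)\<^sup>2 + 2 * (z j)\<^sup>2)"
  proof (intro mult_left_mono sum_mono)
    show "(p j + z j)\<^sup>2 \<le> 2 * (p j)\<^sup>2 + 2 * (z j)\<^sup>2" for j
      using zero_le_power2[of "p j - z j"] by (simp add: power2_sum power2_diff)
  qed simp
  also have "\<dots> = (\<eta> / B)\<^sup>2 * (2 * (vnorm d p)\<^sup>2 + 2 * (vnorm d z)\<^sup>2)"
    by (simp add: L2_set_def sum_nonneg sum.distrib sum_distrib_left)
  also have "\<dots> \<le> (\<eta> / B)\<^sup>2 * (2 * (real B)\<^sup>2 + 2 * (vnorm d z)\<^sup>2)"
    using np by (intro mult_left_mono) auto
  finally have sq: "(vnorm d (\<lambda>j. step x y j - x j))\<^sup>2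
      \<le> (\<eta> / B)\<^sup>2 * (2 * (real B)\<^sup>2 + 2 * (vnorm d z)\<^sup>2)" .
  have "f (step x y) \<le> f x + (\<Sum>j<d. u j * (step x y j - x j)) + K / 2 * (vnorm d (\<lambda>j. step x y j - x j))\<^sup>2"
    unfolding u_def K_def by (rule generalized_smooth_descent[OF f_diff smooth x psac_step_in_vecs])
  also have "(\<Sum>j<d. u j * (step x y j - x j)) = - (\<eta> / B) * (\<Sum>j<d. u j * p j) + (\<Sum>j<d. - (\<eta> / B * u j) * z j)"
    unfolding sum_distrib_left sum.distrib[symmetric]
    by (rule sum.cong) (simp_all add: upd algebra_simps add_divide_distrib)
  also have "- (\<eta> / B) * (\<Sum>j<d. u j * p j) \<le> - (\<eta> * h)"
  proof -
    have "\<eta> / B * (B * h) \<le> \<eta> / B * (\<Sum>j<d. u j * p j)"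
      using hp \<eta> by (intro mult_left_mono) auto
    then show ?thesis using Bpos by simp
  qed
  also have "K / 2 * (vnorm d (\<lambda>j. step x y j - x j))\<^sup>2
      \<le> K / 2 * ((\<eta> / B)\<^sup>2 * (2 * (real B)\<^sup>2 + 2 * (vnorm d z)\<^sup>2))"
    using sq K by (intro mult_left_mono) auto
  also have "\<dots> = K * \<eta>\<^sup>2 + K * \<eta>\<^sup>2 / (real B)\<^sup>2 * (vnorm d z)\<^sup>2"
    using Bpos by (simp add: power_divide field_simps)
  finally show ?thesis
    by (simp add: u_def z_def h_def K_def algebra_simps)
qed

text \<open>The pathwise bound \<open>Q\<close> depends on the randomness only through the noise,
  and its Gaussian mean is \<open>A\<close>. Nonnegativity of \<open>A\<close> is not visible from
  its formula: it holds because \<open>Q\<close> dominates the nonnegative gap after the step. It is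
  recorded since \<open>ennreal\<close> truncates negative numbers.\<close>

lemma
  assumes x: "x \<in> vecs d" and G: "noise_floor \<le> G x"
  defines "A \<equiv> f x - f xm - \<eta> * (c * (G x - noise_floor))
    + (L\<^sub>0 + L\<^sub>1 * G x) * \<eta>\<^sup>2 * (1 + d * \<sigma>\<^sup>2 / (real B)\<^sup>2)"
  shows step_expected_descent: "(\<integral>\<^sup>+ y. ennreal (f (step x y) - f xm) \<partial>M) \<le> ennreal A"
    and step_expected_bound_nonneg: "0 \<le> A"
proof -
  define K where "K = L\<^sub>0 + L\<^sub>1 * G x"
  define Q where "Q = (\<lambda>z. (f x - f xm - \<eta> * (c * (G x - noise_floor)) + K * \<eta>\<^sup>2)
    + (\<Sum>j<d. - (\<eta> / B * grad d f x j) * z j) + K * \<eta>\<^sup>2 / (real B)\<^sup>2 * (vnorm d z)\<^sup>2)"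
  have Q: "has_bochner_integral (gaussian_noise d \<sigma>) Q A"
  proof -
    have "A = f x - f xm - \<eta> * (c * (G x - noise_floor)) + K * \<eta>\<^sup>2
        + K * \<eta>\<^sup>2 / (real B)\<^sup>2 * (d * \<sigma>\<^sup>2)"
      by (simp add: A_def K_def algebra_simps add_divide_distrib)
    then show ?thesis
      unfolding Q_def
      by (simp only: has_bochner_integral_gaussian_noise_quadratic[OF \<sigma>])
  qed
  have le: "f (step x y) - f xm \<le> Q (snd y)" if "y \<in> space M" for y
    using step_descent[OF x G that] by (simp add: Q_def K_def)
  have Q0: "0 \<le> Q z" if "z \<in> space (gaussian_noise d \<sigma>)" for z
  proof -
    \<comment> \<open>Any admissible indices complete \<open>z\<close> to an outcome of the step;
      index 0 exists because the dataset is nonempty.\<close>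
    have "((\<lambda>i\<in>{..<B}. 0), z) \<in> space M"
      using n that by (auto simp: space_psac_step_space space_gaussian_noise)
    from le[OF this] f_gap[OF psac_step_in_vecs] show ?thesis
      by (smt (verit) snd_conv)
  qed
  have [measurable]: "Q \<in> borel_measurable (gaussian_noise d \<sigma>)"
    using Q by (auto simp: has_bochner_integral_iff)
  interpret P: prob_space "\<Pi>\<^sub>M i\<in>{..<B}. uniform_count_measure {..<n}"
    using n by (intro prob_space_PiM prob_space_uniform_count_measure) (auto simp: lessThan_empty_iff)
  interpret N: prob_space "gaussian_noise d \<sigma>" by (rule prob_space_gaussian_noise[OF \<sigma>])
  have "(\<integral>\<^sup>+ y. ennreal (f (step x y) - f xm) \<partial>M) \<le> (\<integral>\<^sup>+ y. ennreal (Q (snd y)) \<partial>M)"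
    using le by (intro nn_integral_mono ennreal_leI)
  also have "\<dots> = (\<integral>\<^sup>+ I. \<integral>\<^sup>+ z. ennreal (Q z) \<partial>gaussian_noise d \<sigma>
      \<partial>(\<Pi>\<^sub>M i\<in>{..<B}. uniform_count_measure {..<n}))"
    by (subst N.nn_integral_fst[symmetric]) simp_all
  also have "\<dots> = (\<integral>\<^sup>+ z. ennreal (Q z) \<partial>gaussian_noise d \<sigma>)"
    by (simp add: P.emeasure_space_1)
  also have "\<dots> = ennreal A"
    using Q Q0 by (subst nn_integral_eq_integral) (auto simp: has_bochner_integral_iff)
  finally show "(\<integral>\<^sup>+ y. ennreal (f (step x y) - f xm) \<partial>M) \<le> ennreal A" .
  have "0 \<le> (\<integral>z. Q z \<partial>gaussian_noise d \<sigma>)"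
    using Q0 by (intro integral_nonneg_AE AE_I2)
  then show "0 \<le> A"
    using Q by (simp add: has_bochner_integral_iff)
qed

end

section \<open>The stopped process\<close>

context psac_run
begin

text \<open>The process is stopped at the first iterate whose gradient norm is at most \<open>\<theta>\<close>: only before
  that time is a decrease of \<open>f\<close> guaranteed, and afterwards the minimum is small anyway.\<close>

definition active :: "real \<Rightarrow> (nat \<Rightarrow> real) \<Rightarrow> (nat \<Rightarrow> (nat \<Rightarrow> nat) \<times> (nat \<Rightarrow> real)) \<Rightarrow> nat \<Rightarrow> bool"
  where "active \<theta> x\<^sub>0 w t \<longleftrightarrow> (\<forall>s\<in>{..t}. \<theta> < G (iter x\<^sub>0 w s))"

definition excess :: "real \<Rightarrow> (nat \<Rightarrow> real) \<Rightarrow> (nat \<Rightarrow> (nat \<Rightarrow> nat) \<times> (nat \<Rightarrow> real)) \<Rightarrow> nat \<Rightarrow> real"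
  where "excess \<theta> x\<^sub>0 w t = (if active \<theta> x\<^sub>0 w t then G (iter x\<^sub>0 w t) - \<theta> else 0)"

text \<open>The remaining gap plus the accumulated guaranteed decreases. Setting the gap to 0 from
  the stopping time on keeps the value nonnegative and constant afterwards, so up to
  \<open>e\<close> per step this is a supermartingale.\<close>

definition potential ::
    "real \<Rightarrow> real \<Rightarrow> (nat \<Rightarrow> real) \<Rightarrow> (nat \<Rightarrow> (nat \<Rightarrow> nat) \<times> (nat \<Rightarrow> real)) \<Rightarrow> nat \<Rightarrow> real"
  where "potential \<theta> b x\<^sub>0 w t =
    (if active \<theta> x\<^sub>0 w t then f (iter x\<^sub>0 w t) - f xm else 0) + (\<Sum>s<t. b * excess \<theta> x\<^sub>0 w s)"

lemma measurable_G_iter: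
  assumes "x\<^sub>0 \<in> vecs d" "t \<le> T"
  shows "(\<lambda>w. G (iter x\<^sub>0 w t)) \<in> borel_measurable (dp_psac_space d n B T \<sigma>)"
  using measurable_compose[OF measurable_dp_psac[OF F assms] measurable_G] .

lemma measurable_potential:
  assumes x: "x\<^sub>0 \<in> vecs d" and T: "T \<ge> t"
  shows "(\<lambda>w. potential \<theta> b x\<^sub>0 w t) \<in> borel_measurable (dp_psac_space d n B T \<sigma>)"
proof -
  let ?S = "dp_psac_space d n B T \<sigma>"
  have G: "(\<lambda>w. G (iter x\<^sub>0 w s)) \<in> borel_measurable ?S" if "s \<le> t" for s
    using T that by (intro measurable_G_iter x) auto
  have [measurable]: "(\<lambda>w. f (iter x\<^sub>0 w t)) \<in> borel_measurable ?S"
    using measurable_compose[OF measurable_dp_psac[OF F x T] measurable_f] .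
  have act: "Measurable.pred ?S (\<lambda>w. active \<theta> x\<^sub>0 w s)" if "s \<le> t" for s
    unfolding active_def
  proof (rule pred_intros_finite(3))
    fix u assume "u \<in> {..s}"
    then have [measurable]: "(\<lambda>w. G (iter x\<^sub>0 w u)) \<in> borel_measurable ?S"
      using that by (intro G) auto
    show "Measurable.pred ?S (\<lambda>w. \<theta> < G (iter x\<^sub>0 w u))" by measurable
  qed simp
  have exc: "(\<lambda>w. excess \<theta> x\<^sub>0 w s) \<in> borel_measurable ?S" if "s \<in> {..<t}" for s
  proof -
    have [measurable]: "Measurable.pred ?S (\<lambda>w. active \<theta> x\<^sub>0 w s)"
      "(\<lambda>w. G (iter x\<^sub>0 w s)) \<in> borel_measurable ?S"
      using that by (auto intro!: act G)
    show ?thesis unfolding excess_def by measurable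
  qed
  note [measurable] = act[OF order_refl]
  have "(\<lambda>w. \<Sum>s<t. b * excess \<theta> x\<^sub>0 w s) \<in> borel_measurable ?S"
    by (intro borel_measurable_sum borel_measurable_times exc) auto
  then show ?thesis
    unfolding potential_def by measurable
qed

lemma excess_nonneg: "excess \<theta> x\<^sub>0 w t \<ge> 0"
  by (force simp: excess_def active_def)

lemma potential_nonneg: "b \<ge> 0 \<Longrightarrow> x\<^sub>0 \<in> vecs d \<Longrightarrow> potential \<theta> b x\<^sub>0 w t \<ge> 0"
  unfolding potential_def using f_gap[OF dp_psac_in_vecs]
  by (intro add_nonneg_nonneg sum_nonneg mult_nonneg_nonneg) (auto simp: excess_nonneg)

text \<open>By \<open>gain\<close>, a step from gradient norm \<open>g\<close> lowers
  \<open>f\<close> in expectation by at least \<open>b * (g - \<theta>)\<close>, up to an error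
  \<open>e\<close>.\<close>

context
  fixes \<theta> b e :: real and x\<^sub>0 :: "nat \<Rightarrow> real"
  assumes \<theta>: "\<theta> \<ge> noise_floor" and b: "b \<ge> 0" and e: "e \<ge> 0" and x\<^sub>0: "x\<^sub>0 \<in> vecs d"
    and gain: "\<And>g. g \<ge> \<theta> \<Longrightarrow> (L\<^sub>0 + L\<^sub>1 * g) * \<eta>\<^sup>2 * (1 + d * \<sigma>\<^sup>2 / (real B)\<^sup>2) + b * (g - \<theta>)
      \<le> \<eta> * (c * (g - noise_floor)) + e"
begin

text \<open>With all other entries of \<open>w\<close> frozen, the past iterates and the sum
  \<open>Z\<close> are constants of the integral over entry \<open>t\<close>. While active, the
  expected one-step descent and \<open>gain\<close> apply; once stopped, the potential no longer
  changes.\<close>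

lemma potential_step:
  "(\<integral>\<^sup>+ y. ennreal (potential \<theta> b x\<^sub>0 (w(t := y)) (Suc t)) \<partial>M) \<le> ennreal (potential \<theta> b x\<^sub>0 w t + e)"
proof -
  interpret prob_space M by (rule prob_space_M)
  define x where "x = iter x\<^sub>0 w t"
  have x: "x \<in> vecs d" unfolding x_def by (rule dp_psac_in_vecs[OF x\<^sub>0])
  define Z where "Z = (\<Sum>s<Suc t. b * excess \<theta> x\<^sub>0 w s)"
  have Z: "Z \<ge> 0" unfolding Z_def by (intro sum_nonneg mult_nonneg_nonneg b excess_nonneg)
  have iter_eq: "iter x\<^sub>0 (w(t := y)) s = iter x\<^sub>0 w s" if "s \<le> t" for s y
    using that by (intro dp_psac_cong) auto
  have iter_Suc: "iter x\<^sub>0 (w(t := y)) (Suc t) = step x y" for y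
    unfolding dp_psac_Suc by (simp add: iter_eq x_def)
  have active_eq: "active \<theta> x\<^sub>0 (w(t := y)) s = active \<theta> x\<^sub>0 w s" if "s \<le> t" for s y
    using that by (simp add: active_def iter_eq)
  have sum_eq: "(\<Sum>s<Suc t. b * excess \<theta> x\<^sub>0 (w(t := y)) s) = Z" for y
    unfolding Z_def by (intro sum.cong) (simp_all add: excess_def active_eq iter_eq)
  have active_Suc: "active \<theta> x\<^sub>0 w' (Suc t) \<Longrightarrow> active \<theta> x\<^sub>0 w' t" for w'
    by (simp add: active_def)
  show ?thesis
  proof (cases "active \<theta> x\<^sub>0 w t")
    case True
    then have G: "\<theta> < G x" by (simp add: active_def x_def)
    have G': "noise_floor \<le> G x" using G \<theta> by simp
    define A where "A = f x - f xm - \<eta> * (c * (G x - noise_floor))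
      + (L\<^sub>0 + L\<^sub>1 * G x) * \<eta>\<^sup>2 * (1 + d * \<sigma>\<^sup>2 / (real B)\<^sup>2)"
    have A: "0 \<le> A" unfolding A_def by (rule step_expected_bound_nonneg[OF x G'])
    have "(\<integral>\<^sup>+ y. ennreal (potential \<theta> b x\<^sub>0 (w(t := y)) (Suc t)) \<partial>M)
        \<le> (\<integral>\<^sup>+ y. ennreal (f (step x y) - f xm) + ennreal Z \<partial>M)"
    proof (rule nn_integral_mono)
      fix y
      have "potential \<theta> b x\<^sub>0 (w(t := y)) (Suc t) \<le> (f (step x y) - f xm) + Z"
        unfolding potential_def sum_eq iter_Suc using f_gap[OF psac_step_in_vecs] by simp
      then have "ennreal (potential \<theta> b x\<^sub>0 (w(t := y)) (Suc t)) \<le> ennreal (f (step x y) - f xm + Z)"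
        by (rule ennreal_leI)
      also have "\<dots> = ennreal (f (step x y) - f xm) + ennreal Z"
        using f_gap[OF psac_step_in_vecs] Z by (intro ennreal_plus) auto
      finally show "ennreal (potential \<theta> b x\<^sub>0 (w(t := y)) (Suc t)) \<le> ennreal (f (step x y) - f xm) + ennreal Z" .
    qed
    also have "\<dots> \<le> ennreal A + ennreal Z"
    proof -
      have "(\<lambda>y. (x, y)) \<in> measurable M ((\<Pi>\<^sub>M j\<in>{..<d}. borel) \<Otimes>\<^sub>M M)"
        using x by (intro measurable_Pair1') (simp add: space_PiM)
      from measurable_compose[OF this measurable_psac_step[OF F]]
      have [measurable]: "step x \<in> measurable M (\<Pi>\<^sub>M j\<in>{..<d}. borel)" by simp
      show ?thesis
        using step_expected_descent[OF x G'] unfolding A_def[symmetric]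
        by (subst nn_integral_add) (simp_all add: emeasure_space_1 add_right_mono)
    qed
    also have "\<dots> = ennreal (A + Z)" using A Z by simp
    also have "\<dots> \<le> ennreal (potential \<theta> b x\<^sub>0 w t + e)"
    proof (rule ennreal_leI)
      have "excess \<theta> x\<^sub>0 w t = G x - \<theta>" using True by (simp add: excess_def x_def)
      then show "A + Z \<le> potential \<theta> b x\<^sub>0 w t + e"
        using gain[of "G x"] G True by (simp add: potential_def Z_def A_def x_def)
    qed
    finally show ?thesis .
  next
    case False
    then have "\<not> active \<theta> x\<^sub>0 (w(t := y)) (Suc t)" for y
      using active_Suc active_eq by blast
    then have "potential \<theta> b x\<^sub>0 (w(t := y)) (Suc t) = potential \<theta> b x\<^sub>0 w t" for y
      using False unfolding potential_def sum_eq by (simp add: Z_def excess_def)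
    then show ?thesis using e by (simp add: emeasure_space_1 ennreal_leI)
  qed
qed

text \<open>Induction on the horizon, which here equals the time: the product measure splits off its
  last factor, whose inner integral is bounded by \<open>potential_step\<close>.\<close>

lemma potential_bound:
  "(\<integral>\<^sup>+ w. ennreal (potential \<theta> b x\<^sub>0 w t) \<partial>dp_psac_space d n B t \<sigma>) \<le> ennreal (f x\<^sub>0 - f xm + t * e)"
proof (induction t)
  case 0
  interpret prob_space "dp_psac_space d n B 0 \<sigma>"
    unfolding dp_psac_space_def by (intro prob_space_PiM prob_space_M)
  have "(\<integral>\<^sup>+ w. ennreal (potential \<theta> b x\<^sub>0 w 0) \<partial>dp_psac_space d n B 0 \<sigma>)
      \<le> (\<integral>\<^sup>+ w. ennreal (f x\<^sub>0 - f xm) \<partial>dp_psac_space d n B 0 \<sigma>)"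
    using f_gap[OF x\<^sub>0] by (intro nn_integral_mono ennreal_leI) (simp add: potential_def)
  then show ?case by (simp add: emeasure_space_1)
next
  case (Suc t)
  interpret product_sigma_finite "\<lambda>_::nat. M"
    by (intro product_sigma_finite.intro prob_space_imp_sigma_finite prob_space_M)
  interpret prob_space "dp_psac_space d n B t \<sigma>"
    unfolding dp_psac_space_def by (intro prob_space_PiM prob_space_M)
  have S: "dp_psac_space d n B (Suc t) \<sigma> = (\<Pi>\<^sub>M s\<in>insert t {..<t}. M)"
    by (simp add: dp_psac_space_def lessThan_Suc)
  have meas: "(\<lambda>w. ennreal (potential \<theta> b x\<^sub>0 w (Suc t))) \<in> borel_measurable (\<Pi>\<^sub>M s\<in>insert t {..<t}. M)"
    using measurable_potential[OF x\<^sub>0, of "Suc t" "Suc t"] unfolding S by measurable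
  have meas': "(\<lambda>w. ennreal (potential \<theta> b x\<^sub>0 w t)) \<in> borel_measurable (dp_psac_space d n B t \<sigma>)"
    using measurable_potential[OF x\<^sub>0, of t t] by measurable
  have "(\<integral>\<^sup>+ w. ennreal (potential \<theta> b x\<^sub>0 w (Suc t)) \<partial>dp_psac_space d n B (Suc t) \<sigma>)
      = (\<integral>\<^sup>+ w. \<integral>\<^sup>+ y. ennreal (potential \<theta> b x\<^sub>0 (w(t := y)) (Suc t)) \<partial>M \<partial>dp_psac_space d n B t \<sigma>)"
    unfolding S by (subst product_nn_integral_insert[OF _ _ meas]) (simp_all add: dp_psac_space_def)
  also have "\<dots> \<le> (\<integral>\<^sup>+ w. ennreal (potential \<theta> b x\<^sub>0 w t) + ennreal e \<partial>dp_psac_space d n B t \<sigma>)"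
  proof (rule nn_integral_mono)
    fix w
    show "(\<integral>\<^sup>+ y. ennreal (potential \<theta> b x\<^sub>0 (w(t := y)) (Suc t)) \<partial>M)
        \<le> ennreal (potential \<theta> b x\<^sub>0 w t) + ennreal e"
      using potential_step[of w t] potential_nonneg[OF b x\<^sub>0] e by simp
  qed
  also have "\<dots> = (\<integral>\<^sup>+ w. ennreal (potential \<theta> b x\<^sub>0 w t) \<partial>dp_psac_space d n B t \<sigma>) + ennreal e"
    using meas' by (subst nn_integral_add) (simp_all add: emeasure_space_1)
  also have "\<dots> \<le> ennreal (f x\<^sub>0 - f xm + t * e) + ennreal e"
    using Suc.IH by (rule add_right_mono)
  also have "\<dots> = ennreal (f x\<^sub>0 - f xm + Suc t * e)"
  proof -
    have "0 \<le> f x\<^sub>0 - f xm + t * e"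
      using f_gap[OF x\<^sub>0] e by simp
    then show ?thesis
      using e by (simp add: ennreal_plus[symmetric] algebra_simps del: ennreal_plus)
  qed
  finally show ?case .
qed

end

section \<open>The expected minimal gradient norm\<close>

definition min_grad :: "(nat \<Rightarrow> real) \<Rightarrow> nat \<Rightarrow> (nat \<Rightarrow> (nat \<Rightarrow> nat) \<times> (nat \<Rightarrow> real)) \<Rightarrow> real"
  where "min_grad x\<^sub>0 T w = (MIN t\<in>{..<T}. G (iter x\<^sub>0 w t))"

lemma min_grad_le: "t < T \<Longrightarrow> min_grad x\<^sub>0 T w \<le> G (iter x\<^sub>0 w t)"
  by (simp add: min_grad_def)

lemma min_grad_nonneg: "T \<ge> 1 \<Longrightarrow> 0 \<le> min_grad x\<^sub>0 T w"
  by (auto simp: min_grad_def lessThan_empty_iff)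

lemma prob_space_dp_psac_space: "prob_space (dp_psac_space d n B T \<sigma>)"
  unfolding dp_psac_space_def by (intro prob_space_PiM prob_space_M)

lemma measurable_min_grad:
  assumes "x\<^sub>0 \<in> vecs d"
  shows "min_grad x\<^sub>0 T \<in> borel_measurable (dp_psac_space d n B T \<sigma>)"
proof -
  have "(\<lambda>w. G (iter x\<^sub>0 w t)) \<in> borel_measurable (dp_psac_space d n B T \<sigma>)" if "t \<in> {..<T}" for t
    using that by (intro measurable_G_iter assms) auto
  then show ?thesis
    unfolding min_grad_def by (intro borel_measurable_Min) auto
qed

text \<open>The deterministic first iterate is among the candidates, so the minimum lies between 0
  and \<open>G x\<^sub>0\<close>.\<close>

lemma integrable_min_grad:
  assumes x: "x\<^sub>0 \<in> vecs d" and T: "T \<ge> 1"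
  shows "integrable (dp_psac_space d n B T \<sigma>) (min_grad x\<^sub>0 T)"
proof -
  interpret prob_space "dp_psac_space d n B T \<sigma>" by (rule prob_space_dp_psac_space)
  have "norm (min_grad x\<^sub>0 T w) \<le> G x\<^sub>0" for w
    using min_grad_le[of 0 T x\<^sub>0 w] min_grad_nonneg[OF T, of x\<^sub>0 w] T by simp
  then show ?thesis
    by (intro integrable_const_bound[where B = "G x\<^sub>0"] measurable_min_grad x) auto
qed

lemma integral_min_grad_le_initial:
  assumes x: "x\<^sub>0 \<in> vecs d" and T: "T \<ge> 1"
  shows "(\<integral>w. min_grad x\<^sub>0 T w \<partial>dp_psac_space d n B T \<sigma>) \<le> G x\<^sub>0"
proof -
  interpret prob_space "dp_psac_space d n B T \<sigma>" by (rule prob_space_dp_psac_space)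
  show ?thesis
    using min_grad_le[of 0 T x\<^sub>0] T
    by (intro integral_le_const integrable_min_grad x T AE_I2) auto
qed

text \<open>If the minimum exceeds \<open>\<theta>\<close>, the process is active at all
  \<open>T\<close> times and every excess is at least that of the minimum; otherwise the left side
  is 0.\<close>

lemma potential_ge_min_grad:
  assumes "b \<ge> 0" "x\<^sub>0 \<in> vecs d"
  shows "b * T * max 0 (min_grad x\<^sub>0 T w - \<theta>) \<le> potential \<theta> b x\<^sub>0 w T"
proof (cases "\<theta> < min_grad x\<^sub>0 T w")
  case False
  then show ?thesis using potential_nonneg[OF assms] by simp
next
  case True
  have act: "active \<theta> x\<^sub>0 w t" if "t < T" for t
    unfolding active_def
  proof
    fix s assume "s \<in> {..t}"
    then show "\<theta> < G (iter x\<^sub>0 w s)"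
      using that True by (intro less_le_trans[OF True min_grad_le]) auto
  qed
  have "b * T * (min_grad x\<^sub>0 T w - \<theta>) = (\<Sum>t<T. b * (min_grad x\<^sub>0 T w - \<theta>))" by simp
  also have "\<dots> \<le> (\<Sum>t<T. b * excess \<theta> x\<^sub>0 w t)"
    using assms(1) act min_grad_le by (intro sum_mono mult_left_mono) (auto simp: excess_def)
  also have "\<dots> \<le> potential \<theta> b x\<^sub>0 w T"
    using f_gap[OF dp_psac_in_vecs[OF assms(2)]] by (simp add: potential_def)
  finally show ?thesis using True by simp
qed

text \<open>The positive part of the excess of the minimum, times \<open>b * T\<close>, lies below
  the potential, whose expectation is bounded by \<open>potential_bound\<close>. That bound is a
  nonnegative integral, so the comparison is made in \<open>ennreal\<close>.\<close>

lemma integral_min_grad_le: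
  assumes \<theta>: "\<theta> \<ge> noise_floor" and b: "b > 0" and e: "e \<ge> 0" and x: "x\<^sub>0 \<in> vecs d" and T: "T \<ge> 1"
    and gain: "\<And>g. g \<ge> \<theta> \<Longrightarrow> (L\<^sub>0 + L\<^sub>1 * g) * \<eta>\<^sup>2 * (1 + d * \<sigma>\<^sup>2 / (real B)\<^sup>2) + b * (g - \<theta>)
      \<le> \<eta> * (c * (g - noise_floor)) + e"
  shows "(\<integral>w. min_grad x\<^sub>0 T w \<partial>dp_psac_space d n B T \<sigma>) \<le> \<theta> + (f x\<^sub>0 - f xm + T * e) / (b * T)"
proof -
  let ?S = "dp_psac_space d n B T \<sigma>"
  let ?m = "\<lambda>w. max 0 (min_grad x\<^sub>0 T w - \<theta>)"
  interpret prob_space ?S by (rule prob_space_dp_psac_space)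
  have im: "integrable ?S ?m"
    using integrable_min_grad[OF x T] by (intro integrable_max) auto
  have bT: "b * T > 0" using b T by simp
  have "ennreal (\<integral>w. b * T * ?m w \<partial>?S) = (\<integral>\<^sup>+ w. ennreal (b * T * ?m w) \<partial>?S)"
    using im bT by (intro nn_integral_eq_integral[symmetric]) auto
  also have "\<dots> \<le> (\<integral>\<^sup>+ w. ennreal (potential \<theta> b x\<^sub>0 w T) \<partial>?S)"
    using b x by (intro nn_integral_mono ennreal_leI potential_ge_min_grad) auto
  also have "\<dots> \<le> ennreal (f x\<^sub>0 - f xm + T * e)"
    using b by (intro potential_bound \<theta> e x gain) auto
  finally have "b * T * (\<integral>w. ?m w \<partial>?S) \<le> f x\<^sub>0 - f xm + T * e"
    using f_gap[OF x] e by (subst (asm) ennreal_le_iff) auto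
  then have "(\<integral>w. ?m w \<partial>?S) \<le> (f x\<^sub>0 - f xm + T * e) / (b * T)"
    using bT by (simp add: le_divide_eq mult.commute)
  moreover have "(\<integral>w. min_grad x\<^sub>0 T w \<partial>?S) \<le> (\<integral>w. \<theta> + ?m w \<partial>?S)"
    using im by (intro integral_mono integrable_min_grad x T Bochner_Integration.integrable_add) auto
  ultimately show ?thesis
    using im by (simp add: prob_space)
qed

end

section \<open>The rate\<close>

lemma N_fun_pos: "0 < \<tau>\<^sub>0 \<Longrightarrow> \<tau>\<^sub>1 < 1 \<Longrightarrow> 0 < r \<Longrightarrow> 0 < N_fun \<tau>\<^sub>0 \<tau>\<^sub>1 r"
  by (auto simp: N_fun_def intro!: divide_pos_pos add_pos_pos mult_pos_pos)

text \<open>Each factor of the denominator is bounded above: \<open>N\<close> by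
  \<open>\<tau>\<^sub>0 / a\<close>, \<open>p\<close> by 1, and \<open>w\<close>, being
  \<open>1 - (1 - sqrt r)\<^sup>2\<close>, by 1. The fraction is thus at least
  \<open>8 * \<tau>\<^sub>0 / (3 * a\<^sup>2)\<close>, which suffices because \<open>a\<close> is at
  most 1.\<close>

lemma bias_ge:
  assumes \<tau>: "0 < \<tau>\<^sub>0" "0 \<le> \<tau>\<^sub>1" "\<tau>\<^sub>1 < 1" and r: "0 < r" "r \<le> 1"
  shows "2 * (\<tau>\<^sub>0 / (1 - \<tau>\<^sub>1)) \<le> 8 * \<tau>\<^sub>0\<^sup>2 * (1 + \<tau>\<^sub>0) /
    (3 * N_fun \<tau>\<^sub>0 \<tau>\<^sub>1 r * (1 - \<tau>\<^sub>1) ^ 3 *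
      (\<tau>\<^sub>0 + r * (1 - \<tau>\<^sub>1) / (2 * \<tau>\<^sub>0 + r * (1 - \<tau>\<^sub>1))) * (2 * sqrt r - r))"
proof -
  define a where "a = 1 - \<tau>\<^sub>1"
  define p where "p = r * a / (2 * \<tau>\<^sub>0 + r * a)"
  define N where "N = N_fun \<tau>\<^sub>0 \<tau>\<^sub>1 r"
  define w where "w = 2 * sqrt r - r"
  have a: "0 < a" "a \<le> 1" using \<tau> by (auto simp: a_def)
  have N: "0 < N" "N \<le> \<tau>\<^sub>0 / a" using N_fun_pos[OF \<tau>(1,3) r(1)] by (auto simp: N_def N_fun_def a_def)
  have p: "0 < p" "p \<le> 1" using a \<tau> r by (auto simp: p_def divide_le_eq_1 add_pos_pos intro!: divide_pos_pos)
  have "w = sqrt r * (2 - sqrt r)" using r by (simp add: w_def algebra_simps)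
  also have "\<dots> > 0" using r real_sqrt_le_1_iff[of r] by (intro mult_pos_pos) (simp, linarith)
  finally have "0 < w" .
  moreover have "w = 1 - (1 - sqrt r)\<^sup>2" using r by (simp add: w_def power2_diff)
  ultimately have w: "0 < w" "w \<le> 1" by simp_all
  have den: "0 < 3 * N * a ^ 3 * (\<tau>\<^sub>0 + p) * w"
    using N a p w \<tau> by (intro mult_pos_pos) auto
  have "3 * N * a ^ 3 * (\<tau>\<^sub>0 + p) * w \<le> 3 * (\<tau>\<^sub>0 / a) * a ^ 3 * (\<tau>\<^sub>0 + 1) * 1"
    using N a p w \<tau> by (intro mult_mono mult_nonneg_nonneg) auto
  also have "\<dots> = 3 * \<tau>\<^sub>0 * a\<^sup>2 * (1 + \<tau>\<^sub>0)"
    using a by (simp add: power3_eq_cube power2_eq_square)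
  finally have "2 * (\<tau>\<^sub>0 / a) * (3 * N * a ^ 3 * (\<tau>\<^sub>0 + p) * w) \<le> 2 * (\<tau>\<^sub>0 / a) * (3 * \<tau>\<^sub>0 * a\<^sup>2 * (1 + \<tau>\<^sub>0))"
    using a \<tau> by (intro mult_left_mono) auto
  also have "\<dots> = 6 * \<tau>\<^sub>0\<^sup>2 * (1 + \<tau>\<^sub>0) * a"
    using a by (simp add: power2_eq_square)
  also have "\<dots> \<le> 6 * \<tau>\<^sub>0\<^sup>2 * (1 + \<tau>\<^sub>0) * 1"
    using a \<tau> by (intro mult_left_mono) auto
  also have "\<dots> \<le> 8 * \<tau>\<^sub>0\<^sup>2 * (1 + \<tau>\<^sub>0)"
    using \<tau> by simp
  finally show ?thesis
    using den unfolding N_def p_def a_def w_def by (simp add: le_divide_eq)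
qed

section \<open>Choice of the constants and the two regimes of the rate\<close>

theorem corollary1:
  fixes L\<^sub>0 L\<^sub>1 \<tau>\<^sub>0 \<tau>\<^sub>1 r c\<^sub>2 :: real
  assumes "L\<^sub>0 > 0" and "L\<^sub>1 \<ge> 0" and "\<tau>\<^sub>0 > 0" and "0 \<le> \<tau>\<^sub>1" and "\<tau>\<^sub>1 < 1"
    and "0 < r" and "r \<le> 1" and "c\<^sub>2 > 0"
  shows "\<exists>\<kappa>>0. \<forall>\<Delta>. \<exists>K>0.
    \<forall>(d::nat) (n::nat) (B::nat) (T::nat) (\<epsilon>::real) (\<delta>::real) (q::real) (\<sigma>::real) (\<eta>::real)
      (F :: nat \<Rightarrow> (nat \<Rightarrow> real) \<Rightarrow> real) x\<^sub>0 xstar.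
      d \<ge> 1 \<longrightarrow> n \<ge> 1 \<longrightarrow> B \<ge> 1 \<longrightarrow> \<epsilon> > 0 \<longrightarrow> 0 < \<delta> \<longrightarrow> \<delta> < 1 \<longrightarrow>
      (\<forall>i<n. differentiable_vecs d (F i)) \<longrightarrow>
      generalized_smooth d L\<^sub>0 L\<^sub>1 (emp_risk n F) \<longrightarrow>
      bounded_variance d n \<tau>\<^sub>0 \<tau>\<^sub>1 F \<longrightarrow>
      x\<^sub>0 \<in> vecs d \<longrightarrow> minimizer d (emp_risk n F) xstar \<longrightarrow>
      emp_risk n F x\<^sub>0 - emp_risk n F xstar = \<Delta> \<longrightarrow>
      q = real B / real n \<longrightarrow>
      \<sigma> = c\<^sub>2 * (q * sqrt (real T * ln (1 / \<delta>)) / \<epsilon>) \<longrightarrow>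
      \<eta> = sqrt (2 * (real B)\<^sup>2 / (real d * \<sigma>\<^sup>2 * real T * (L\<^sub>0 + L\<^sub>1 * (\<tau>\<^sub>0 + 1)))) \<longrightarrow>
      real T \<ge> \<kappa> * ((real n)\<^sup>2 * \<epsilon>\<^sup>2 / (real d * ln (1 / \<delta>))) \<longrightarrow>
      real n \<ge> sample_threshold L\<^sub>0 L\<^sub>1 \<tau>\<^sub>0 \<tau>\<^sub>1 r c\<^sub>2 d \<epsilon> \<delta> \<longrightarrow>
      integrable (dp_psac_space d n B T \<sigma>)
        (\<lambda>\<omega>. MIN t\<in>{..<T}. vnorm d (grad d (emp_risk n F) (dp_psac d B r \<eta> F x\<^sub>0 \<omega> t))) \<and>
      (\<integral>\<omega>. (MIN t\<in>{..<T}. vnorm d (grad d (emp_risk n F) (dp_psac d B r \<eta> F x\<^sub>0 \<omega> t)))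
        \<partial>dp_psac_space d n B T \<sigma>)
      \<le> K * sqrt (sqrt (real d * ln (1 / \<delta>)) / (real n * \<epsilon>)) +
        8 * \<tau>\<^sub>0\<^sup>2 * (1 + \<tau>\<^sub>0) /
          (3 * N_fun \<tau>\<^sub>0 \<tau>\<^sub>1 r * (1 - \<tau>\<^sub>1) ^ 3 *
           (\<tau>\<^sub>0 + r * (1 - \<tau>\<^sub>1) / (2 * \<tau>\<^sub>0 + r * (1 - \<tau>\<^sub>1))) * (2 * sqrt r - r))"
proof -
  define L where "L = L\<^sub>0 + L\<^sub>1 * (\<tau>\<^sub>0 + 1)"
  define l where "l = sqrt (2 / L)"
  define c where "c = (1 - \<tau>\<^sub>1) * \<tau>\<^sub>0 / (2 * \<tau>\<^sub>0 + (1 - \<tau>\<^sub>1))"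
  \<comment> \<open>Below \<open>s\<^sub>0\<close> the part of the second-order term that is
    proportional to the gradient norm fits into half of the decrease, which needs
    \<open>8 * L\<^sub>1 * c\<^sub>2 * s \<le> c * l * L\<close>. Using \<open>L\<^sub>1 + 1\<close>
    keeps the quotient defined when \<open>L\<^sub>1 = 0\<close>.\<close>
  define s\<^sub>0 where "s\<^sub>0 = c * l * L / (8 * c\<^sub>2 * (L\<^sub>1 + 1))"
  define bias where "bias = 8 * \<tau>\<^sub>0\<^sup>2 * (1 + \<tau>\<^sub>0) /
    (3 * N_fun \<tau>\<^sub>0 \<tau>\<^sub>1 r * (1 - \<tau>\<^sub>1) ^ 3 *
      (\<tau>\<^sub>0 + r * (1 - \<tau>\<^sub>1) / (2 * \<tau>\<^sub>0 + r * (1 - \<tau>\<^sub>1))) * (2 * sqrt r - r))"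
  \<comment> \<open>With this value the lower bound on \<open>T\<close> says that
    \<open>c\<^sub>2\<^sup>2 * s\<^sup>2 * T\<close>, which equals
    \<open>d * \<sigma>\<^sup>2 / (real B)\<^sup>2\<close>, is at least 1.\<close>
  define \<kappa> where "\<kappa> = 1 / c\<^sub>2\<^sup>2"
  \<comment> \<open>The bound of \<open>grad_norm_le_gap\<close> on the initial gradient. The
    absolute value makes it positive for every real \<open>\<Delta>\<close>, as a positive
    \<open>K\<close> must be given before \<open>\<Delta>\<close> is known to be a gap.\<close>
  define \<Gamma> where "\<Gamma> = (\<lambda>\<Delta>::real. 1 + 2 * \<bar>\<Delta>\<bar> * (L\<^sub>0 + L\<^sub>1))"
  \<comment> \<open>The first summand serves the regime \<open>s\<^sub>0 \<le> s\<close>, the second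
    the regime \<open>s < s\<^sub>0\<close>.\<close>
  define K where "K = (\<lambda>\<Delta>. \<Gamma> \<Delta> / sqrt s\<^sub>0 + 2 * (\<bar>\<Delta>\<bar> + 4) * c\<^sub>2 * sqrt s\<^sub>0 / (l * c))"
  have "L\<^sub>1 * (\<tau>\<^sub>0 + 1) \<ge> 0" using assms by simp
  then have L: "L > 0" "L\<^sub>0 \<le> L" unfolding L_def using assms(1) by linarith+
  have l: "l > 0" "l\<^sup>2 = 2 / L" using L by (auto simp: l_def)
  have c: "c > 0" using assms by (auto simp: c_def intro!: divide_pos_pos mult_pos_pos)
  have s\<^sub>0: "s\<^sub>0 > 0" using c l L assms by (auto simp: s\<^sub>0_def intro!: divide_pos_pos mult_pos_pos)
  have \<Gamma>: "\<Gamma> \<Delta> > 0" for \<Delta> using assms by (auto simp: \<Gamma>_def intro!: add_pos_nonneg)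
  have K1: "\<Gamma> \<Delta> / sqrt s\<^sub>0 > 0" for \<Delta> using \<Gamma>[of \<Delta>] s\<^sub>0 by simp
  have K2: "2 * (\<bar>\<Delta>\<bar> + 4) * c\<^sub>2 * sqrt s\<^sub>0 / (l * c) > 0" for \<Delta>
    using s\<^sub>0 l c assms by (intro divide_pos_pos mult_pos_pos) auto
  have K: "K \<Delta> > 0" for \<Delta> using K1[of \<Delta>] K2[of \<Delta>] by (simp add: K_def)
  have bias: "2 * (\<tau>\<^sub>0 / (1 - \<tau>\<^sub>1)) \<le> bias"
    unfolding bias_def using assms by (intro bias_ge) auto
  then have bias0: "0 \<le> bias" using assms by (smt (verit) divide_nonneg_pos)
  show ?thesis
    unfolding L_def[symmetric] bias_def[symmetric]
  proof (rule exI[of _ \<kappa>], intro conjI allI)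
    show "\<kappa> > 0" using assms by (simp add: \<kappa>_def)
    fix \<Delta> :: real
    show "\<exists>K>0. \<forall>(d::nat) (n::nat) (B::nat) (T::nat) (\<epsilon>::real) (\<delta>::real) (q::real) (\<sigma>::real) (\<eta>::real)
      (F :: nat \<Rightarrow> (nat \<Rightarrow> real) \<Rightarrow> real) x\<^sub>0 xstar.
      d \<ge> 1 \<longrightarrow> n \<ge> 1 \<longrightarrow> B \<ge> 1 \<longrightarrow> \<epsilon> > 0 \<longrightarrow> 0 < \<delta> \<longrightarrow> \<delta> < 1 \<longrightarrow>
      (\<forall>i<n. differentiable_vecs d (F i)) \<longrightarrow>
      generalized_smooth d L\<^sub>0 L\<^sub>1 (emp_risk n F) \<longrightarrow>
      bounded_variance d n \<tau>\<^sub>0 \<tau>\<^sub>1 F \<longrightarrow>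
      x\<^sub>0 \<in> vecs d \<longrightarrow> minimizer d (emp_risk n F) xstar \<longrightarrow>
      emp_risk n F x\<^sub>0 - emp_risk n F xstar = \<Delta> \<longrightarrow>
      q = real B / real n \<longrightarrow>
      \<sigma> = c\<^sub>2 * (q * sqrt (real T * ln (1 / \<delta>)) / \<epsilon>) \<longrightarrow>
      \<eta> = sqrt (2 * (real B)\<^sup>2 / (real d * \<sigma>\<^sup>2 * real T * L)) \<longrightarrow>
      real T \<ge> \<kappa> * ((real n)\<^sup>2 * \<epsilon>\<^sup>2 / (real d * ln (1 / \<delta>))) \<longrightarrow>
      real n \<ge> sample_threshold L\<^sub>0 L\<^sub>1 \<tau>\<^sub>0 \<tau>\<^sub>1 r c\<^sub>2 d \<epsilon> \<delta> \<longrightarrow>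
      integrable (dp_psac_space d n B T \<sigma>)
        (\<lambda>\<omega>. MIN t\<in>{..<T}. vnorm d (grad d (emp_risk n F) (dp_psac d B r \<eta> F x\<^sub>0 \<omega> t))) \<and>
      (\<integral>\<omega>. (MIN t\<in>{..<T}. vnorm d (grad d (emp_risk n F) (dp_psac d B r \<eta> F x\<^sub>0 \<omega> t)))
        \<partial>dp_psac_space d n B T \<sigma>)
      \<le> K * sqrt (sqrt (real d * ln (1 / \<delta>)) / (real n * \<epsilon>)) + bias"
    proof (rule exI[of _ "K \<Delta>"], intro conjI[OF K] allI impI, goal_cases)
      case (1 d n B T \<epsilon> \<delta> q \<sigma> \<eta> F x\<^sub>0 xstar)
      define s where "s = sqrt (d * ln (1 / \<delta>)) / (n * \<epsilon>)"
      have ln: "ln (1 / \<delta>) > 0" using 1 by simp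
      have pos: "real d > 0" "real n > 0" "real B > 0" using 1 by auto
      have s: "s > 0" using ln pos 1 by (simp add: s_def)
      have s2: "s\<^sup>2 = d * ln (1 / \<delta>) / (n\<^sup>2 * \<epsilon>\<^sup>2)"
        using ln pos by (simp add: s_def power_divide power_mult_distrib)
      have T_ge: "1 / (c\<^sub>2\<^sup>2 * s\<^sup>2) \<le> T"
        using 1(16) by (simp add: \<kappa>_def s2 field_simps)
      then have T_pos: "real T > 0"
        using assms s by (smt (verit) divide_pos_pos mult_pos_pos zero_less_power)
      then have T: "T \<ge> 1" by simp
      have \<sigma>: "\<sigma> > 0" using 1 ln pos T_pos assms by simp
      \<comment> \<open>The batch size cancels through \<open>q = B / n\<close>; from here on only
        \<open>s\<close> and \<open>T\<close> matter.\<close>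
      have \<sigma>2: "d * \<sigma>\<^sup>2 / (real B)\<^sup>2 = c\<^sub>2\<^sup>2 * s\<^sup>2 * T"
        using ln pos T_pos 1(4) unfolding 1(14) 1(13) s2
        by (simp add: power_mult_distrib power_divide field_simps)
      have \<eta>: "\<eta> = l / (c\<^sub>2 * s * T)"
      proof -
        have "d * \<sigma>\<^sup>2 * T * L = (real B)\<^sup>2 * (c\<^sub>2 * s * T)\<^sup>2 * L"
          using \<sigma>2 pos by (simp add: field_simps power2_eq_square)
        then have "2 * (real B)\<^sup>2 / (d * \<sigma>\<^sup>2 * T * L) = (l / (c\<^sub>2 * s * T))\<^sup>2"
          using pos l L by (simp add: power_divide)
        then show ?thesis
          using 1(15) l s T_pos assms by simp
      qed
      have \<eta>_pos: "\<eta> > 0" unfolding \<eta> using l s T_pos assms by simp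
      interpret R: psac_run d n B r \<eta> \<sigma> L\<^sub>0 L\<^sub>1 \<tau>\<^sub>0 \<tau>\<^sub>1 F xstar
        using 1 assms \<eta>_pos \<sigma> by unfold_locales auto
      have \<Delta>: "emp_risk n F x\<^sub>0 - emp_risk n F xstar = \<Delta>" "\<Delta> \<ge> 0"
        using 1(12) R.f_gap[OF 1(10)] by auto
      have "(\<integral>\<omega>. R.min_grad x\<^sub>0 T \<omega> \<partial>dp_psac_space d n B T \<sigma>) \<le> K \<Delta> * sqrt s + bias"
      proof (cases "s\<^sub>0 \<le> s")
        case True
        have "(\<integral>\<omega>. R.min_grad x\<^sub>0 T \<omega> \<partial>dp_psac_space d n B T \<sigma>) \<le> \<Gamma> \<Delta>"
          using R.integral_min_grad_le_initial[OF 1(10) T] \<Delta>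
            grad_norm_le_gap[OF R.f_diff R.smooth R.L 1(10) R.xm]
          by (simp add: \<Gamma>_def)
        also have "\<dots> = \<Gamma> \<Delta> / sqrt s\<^sub>0 * sqrt s\<^sub>0" using s\<^sub>0 by simp
        also have "\<dots> \<le> K \<Delta> * sqrt s"
          using True s\<^sub>0 K1[of \<Delta>] K2[of \<Delta>] by (intro mult_mono) (auto simp: K_def)
        finally show ?thesis using bias0 by simp
      next
        case False
        have c_eq: "R.c = c" by (simp add: R.c_def c_def)
        \<comment> \<open>With these choices \<open>\<eta> * c * (g - noise_floor)\<close> is
          exactly \<open>b * (g - \<theta>) + b * g\<close>: one half of the decrease is retained,
          and \<open>b * g\<close> is free to absorb second-order terms.\<close>
        define b where "b = \<eta> * c / 2"
        define \<theta> where "\<theta> = 2 * R.noise_floor"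
        have nf: "R.noise_floor > 0" using assms by (simp add: R.noise_floor_def)
        have bT: "b * T = l * c / (2 * c\<^sub>2 * s)"
          using T_pos by (simp add: b_def \<eta>)
        have gain: "(L\<^sub>0 + L\<^sub>1 * g) * \<eta>\<^sup>2 * (1 + d * \<sigma>\<^sup>2 / (real B)\<^sup>2) + b * (g - \<theta>)
            \<le> \<eta> * (R.c * (g - R.noise_floor)) + 4 / T" if "g \<ge> \<theta>" for g
        proof -
          have g: "g \<ge> 0" using that nf by (simp add: \<theta>_def)
          have "1 \<le> c\<^sub>2\<^sup>2 * s\<^sup>2 * T"
            using T_ge assms s by (simp add: field_simps)
          then have "\<eta>\<^sup>2 * (1 + d * \<sigma>\<^sup>2 / (real B)\<^sup>2) \<le> \<eta>\<^sup>2 * (2 * (c\<^sub>2\<^sup>2 * s\<^sup>2 * T))"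
            unfolding \<sigma>2 by (intro mult_left_mono) (linarith, simp)
          also have "\<dots> = 4 / (L * T)"
            using s T_pos assms l(2) by (simp add: \<eta> power_divide power_mult_distrib power2_eq_square[of "real T"])
          finally have "(L\<^sub>0 + L\<^sub>1 * g) * (\<eta>\<^sup>2 * (1 + d * \<sigma>\<^sup>2 / (real B)\<^sup>2)) \<le> (L\<^sub>0 + L\<^sub>1 * g) * (4 / (L * T))"
            using g assms by (intro mult_left_mono) auto
          \<comment> \<open>The constant part is at most \<open>4 / T\<close>, which adds up to 4
            over the run; the part linear in \<open>g\<close> goes into
            \<open>b * g\<close>.\<close>
          also have "\<dots> = L\<^sub>0 / L * (4 / T) + L\<^sub>1 * 4 / (L * T) * g"
            by (simp add: distrib_right add_divide_distrib mult_ac)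
          also have "L\<^sub>0 / L * (4 / T) \<le> 1 * (4 / T)"
            using L T_pos by (intro mult_right_mono) auto
          also have "L\<^sub>1 * 4 / (L * T) * g \<le> b * g"
          proof (intro mult_right_mono g)
            have "8 * L\<^sub>1 * c\<^sub>2 * s \<le> 8 * (L\<^sub>1 + 1) * c\<^sub>2 * s\<^sub>0"
              using False s assms by (intro mult_mono) auto
            also have "\<dots> = c * l * L"
              using assms by (simp add: s\<^sub>0_def)
            finally show "L\<^sub>1 * 4 / (L * T) \<le> b"
              using L s T_pos assms by (simp add: b_def \<eta> field_simps)
          qed
          finally have "(L\<^sub>0 + L\<^sub>1 * g) * \<eta>\<^sup>2 * (1 + d * \<sigma>\<^sup>2 / (real B)\<^sup>2) \<le> 4 / T + b * g"
            by (simp only: mult.assoc mult_1)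
          moreover have "b * (g - \<theta>) = \<eta> * (c * (g - R.noise_floor)) - b * g"
            by (simp add: b_def \<theta>_def algebra_simps)
          ultimately show ?thesis
            unfolding c_eq by linarith
        qed
        have b: "b > 0" using \<eta>_pos c by (simp add: b_def)
        have "(\<integral>\<omega>. R.min_grad x\<^sub>0 T \<omega> \<partial>dp_psac_space d n B T \<sigma>) \<le> \<theta> + (\<Delta> + T * (4 / T)) / (b * T)"
          using R.integral_min_grad_le[OF _ b _ 1(10) T gain] nf \<Delta> by (simp add: \<theta>_def)
        \<comment> \<open>The bound obtained is of order \<open>s\<close>. To match the claimed
          rate, one factor \<open>sqrt s\<close> is replaced by the constant
          \<open>sqrt s\<^sub>0\<close>.\<close>
        also have "(\<Delta> + T * (4 / T)) / (b * T) = 2 * (\<Delta> + 4) * c\<^sub>2 / (l * c) * (sqrt s * sqrt s)"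
          using T_pos s by (simp add: bT)
        also have "\<dots> \<le> 2 * (\<Delta> + 4) * c\<^sub>2 / (l * c) * (sqrt s\<^sub>0 * sqrt s)"
          using False s l c \<Delta> assms by (intro mult_left_mono mult_right_mono) auto
        also have "\<dots> = 2 * (\<bar>\<Delta>\<bar> + 4) * c\<^sub>2 * sqrt s\<^sub>0 / (l * c) * sqrt s"
          using \<Delta> by simp
        also have "\<dots> \<le> K \<Delta> * sqrt s"
          using K1[of \<Delta>] s by (intro mult_right_mono) (auto simp: K_def)
        also have "\<theta> \<le> bias" using bias by (simp add: \<theta>_def R.noise_floor_def)
        finally show ?thesis by simp
      qed
      then show ?case
        using R.integrable_min_grad[OF 1(10) T]
        unfolding R.min_grad_def[abs_def] s_def by simp
    qed
  qed
qed

end
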